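(* Let $H$ be a separable Hilbert space and fix $n>0$. Let $(X_1,\dots,X_n)$ be $H$-valued and $(\epsilon_1,\dots,\epsilon_n)$ real-valued random variables, and $(\mathcal{F}_t)_{t\geq 0}$ a filtration such that for all $t$: $X_t$ is $\mathcal{F}_{t-1}$-measurable, $\epsilon_t$ is $\mathcal{F}_t$-measurable, and $\mathbb{E}[\epsilon_t\mid\mathcal{F}_{t-1}]=0$. Suppose $|\epsilon_i|\le B$ and $\mathrm{Var}(\epsilon_i\mid\mathcal{F}_{i-1})\le\sigma_i^2$ almost surely, with $\sigma_i$ $\mathcal{F}_{i-1}$-measurable. Fix $\rho>0$ and set $V_t=\sum_{i\leq t}X_iX_i^T$, $M_t=\sum_{i\le t}X_i\epsilon_i$, $G_t=(\rho I+V_t)^{-1/2}X_t$. If $\sum_{i\le n}\sigma_i^2\|G_i\|^2\le C_n^2$ almost surely for a deterministic $C_n\ge0$, then for $\delta\in(0,1)$, with probability at least $1-\delta$, $$\sup_{t\le n}\|(\rho I+V_t)^{-1/2}M_t\|\le \frac{C_n^2}{B}\,h^{-1}\Big(\frac{B^2}{C_n^2}\log(2/\delta)\Big),$$ where $h(u)=(1+u)\log(1+u)-u$. Equivalently, for all $r\ge0$, $$\mathbb{P}\Big(\sup_{t\le n}\|(\rho I+V_t)^{-1/2}M_t\|\ge r\Big)\le 2\exp\Big(-\frac{C_n^2}{B^2}h\Big(\frac{Br}{C_n^2}\Big)\Big).$$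
   Context: For $f,g\in H$, $fg^T$ denotes the operator $f\langle g,\cdot\rangle$ on $H$, and $I$ is the identity operator on $H$. *)

theory Defs
  imports "HOL-Probability.Probability"
begin

definition outer :: "'h::real_inner \<Rightarrow> 'h \<Rightarrow> ('h \<Rightarrow> 'h)" where
  "outer f g = (\<lambda>x. inner g x *\<^sub>R f)"

definition inv_sqrt_op :: "('h::real_inner \<Rightarrow> 'h) \<Rightarrow> ('h \<Rightarrow> 'h)" where
  "inv_sqrt_op A = (THE S. bounded_linear S
      \<and> (\<forall>x y. inner (S x) y = inner x (S y))
      \<and> (\<forall>x. 0 \<le> inner (S x) x)
      \<and> (\<forall>x. S (S (A x)) = x) \<and> (\<forall>x. A (S (S x)) = x))"

definition Vop :: "(nat \<Rightarrow> 'a \<Rightarrow> 'h::real_inner) \<Rightarrow> nat \<Rightarrow> 'a \<Rightarrow> ('h \<Rightarrow> 'h)" where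
  "Vop X t w = (\<lambda>x. \<Sum>i\<in>{1..t}. outer (X i w) (X i w) x)"

definition regop :: "real \<Rightarrow> (nat \<Rightarrow> 'a \<Rightarrow> 'h::real_inner) \<Rightarrow> nat \<Rightarrow> 'a \<Rightarrow> ('h \<Rightarrow> 'h)" where
  "regop \<rho> X t w = (\<lambda>x. \<rho> *\<^sub>R x + Vop X t w x)"

definition Msum :: "(nat \<Rightarrow> 'a \<Rightarrow> 'h::real_inner) \<Rightarrow> (nat \<Rightarrow> 'a \<Rightarrow> real) \<Rightarrow> nat \<Rightarrow> 'a \<Rightarrow> 'h" where
  "Msum X \<epsilon> t w = (\<Sum>i\<in>{1..t}. \<epsilon> i w *\<^sub>R X i w)"

definition hfun :: "real \<Rightarrow> real" where
  "hfun u = (1 + u) * ln (1 + u) - u"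

definition hfun_inv :: "real \<Rightarrow> real" where
  "hfun_inv y = (THE u. 0 \<le> u \<and> hfun u = y)"

end

theory Submission
  imports Defs "HOL-Real_Asymp.Real_Asymp"
begin

text \<open>
  Write \<open>Z\<^sub>t\<close> for the norm of \<open>(\<rho> I + V\<^sub>t)\<^sup>-\<^sup>1\<^sup>/\<^sup>2 M\<^sub>t\<close>. As \<open>V\<^sub>t\<close> is known at time \<open>t - 1\<close> and increases in \<open>t\<close>,
  the vector at time \<open>t\<close> is a predictable vector of norm at most \<open>Z\<^sub>t\<^sub>-\<^sub>1\<close> plus \<open>\<epsilon>\<^sub>t G\<^sub>t\<close>, and
  \<open>\<parallel>G\<^sub>t\<parallel> \<le> 1\<close>. Pinelis' inequality for \<open>cosh\<close> of a Hilbert space norm then makes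
  \<open>cosh (l Z\<^sub>t) exp (- \<phi>(l) \<Sum>\<^sub>i\<^sub>\<le>\<^sub>t \<sigma>\<^sub>i\<^sup>2 \<parallel>G\<^sub>i\<parallel>\<^sup>2)\<close> with \<open>\<phi>(l) = (exp (l B) - 1 - l B) / B\<^sup>2\<close> a
  nonnegative supermartingale, and the maximal inequality gives the tail bound
  \<open>2 exp (\<phi>(l) C\<^sup>2 - l r)\<close>, which is optimal at \<open>l = ln (1 + B r / C\<^sup>2) / B\<close>. For \<open>C = 0\<close>, let
  \<open>l\<close> tend to infinity instead.
\<close>

section \<open>Inequalities for cosh, exp and h\<close>

lemma cosh_mono_nonneg: "0 \<le> x \<Longrightarrow> x \<le> y \<Longrightarrow> cosh x \<le> cosh (y::real)"
  by (simp add: cosh_real_nonneg_le_iff)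

text \<open>As a function of \<open>z^2\<close>, \<open>cosh z\<close> is a power series with
  nonnegative coefficients, hence convex. Convexity of powers is applied to each term.\<close>

lemma cosh_convex_in_square:
  fixes x y z s :: real
  assumes "0 \<le> s" "s \<le> 1" and z: "z\<^sup>2 = (1 - s) * x\<^sup>2 + s * y\<^sup>2"
  shows "cosh z \<le> (1 - s) * cosh x + s * cosh y"
proof -
  let ?c = "\<lambda>x::real. \<lambda>n. if even n then x ^ n /\<^sub>R fact n else 0"
  have pow: "z ^ n \<le> (1 - s) * x ^ n + s * y ^ n" if "even n" for n
  proof -
    from that obtain k where k: "n = 2 * k" by (elim evenE)
    have "((1 - s) * x\<^sup>2 + s * y\<^sup>2) ^ k \<le> (1 - s) * (x\<^sup>2) ^ k + s * (y\<^sup>2) ^ k"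
    proof -
      have "convex_on {0::real..} (\<lambda>x. x ^ k)"
        using convex_power_odd convex_on_subset[OF convex_power_even, of k "{0..}"]
        by (cases "even k") auto
      from convex_onD[OF this, of s "x\<^sup>2" "y\<^sup>2"] show ?thesis
        using assms by simp
    qed
    then show ?thesis by (simp add: k power_mult z)
  qed
  have "?c z n \<le> (1 - s) * ?c x n + s * ?c y n" for n
  proof (cases "even n")
    case True
    then show ?thesis
      using mult_left_mono[OF pow[OF True], of "inverse (fact n)"] by (simp add: algebra_simps)
  qed simp
  moreover have "(\<lambda>n. (1 - s) * ?c x n + s * ?c y n) sums ((1 - s) * cosh x + s * cosh y)"
    by (intro sums_add sums_mult cosh_converges)
  ultimately show ?thesis
    by (rule sums_le[OF _ cosh_converges])
qed

lemma le_sinh: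
  fixes x :: real
  assumes "0 \<le> x"
  shows "x \<le> sinh x"
proof -
  have "(\<lambda>x. sinh x - x) 0 \<le> (\<lambda>x. sinh x - x) x"
  proof (rule DERIV_nonneg_imp_nondecreasing[OF assms])
    fix y :: real
    show "\<exists>d. ((\<lambda>x. sinh x - x) has_real_derivative d) (at y) \<and> 0 \<le> d"
      by (rule exI[of _ "cosh y - 1"]) (auto intro!: derivative_eq_intros simp: cosh_real_ge_1)
  qed
  then show ?thesis by simp
qed

text \<open>Both sides depend on \<open>x\<close> and \<open>d\<close> only through their norms and their inner product, and
  for fixed norms the left side is convex and the right side affine in the latter. So it suffices
  to compare them for \<open>d\<close> parallel to \<open>x\<close>, that is, at \<open>norm x \<plusminus> norm d\<close>.\<close>
lemma cosh_norm_add_le: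
  fixes x d :: "'h::real_inner"
  shows "cosh (norm (x + d)) \<le> cosh (norm x) + sinh (norm x) / norm x * inner x d
           + cosh (norm x) * (exp (norm d) - 1 - norm d)"
proof -
  define p q where "p = norm x" and "q = norm d"
  \<comment> \<open>The weight that makes \<open>(norm (x + d))^2\<close> a convex combination of
    \<open>(p - q)^2\<close> and \<open>(p + q)^2\<close>. If \<open>p * q = 0\<close>, division by
    zero gives \<open>s = 1/2\<close>.\<close>
  define s where "s = (1 + inner x d / (p * q)) / 2"
  have cs: "\<bar>inner x d\<bar> \<le> p * q"
    unfolding p_def q_def by (rule Cauchy_Schwarz_ineq2)
  have pq: "p \<ge> 0" "q \<ge> 0" by (auto simp: p_def q_def)
  have xd: "inner x d = (2 * s - 1) * (p * q)"
    using cs by (cases "p * q = 0") (auto simp: s_def field_simps)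
  have "\<bar>inner x d / (p * q)\<bar> \<le> 1"
    using cs pq by (cases "p * q = 0") (auto simp: abs_div field_simps)
  then have s: "0 \<le> s" "s \<le> 1" by (simp_all only: s_def abs_le_iff) auto
  have "(norm (x + d))\<^sup>2 = p\<^sup>2 + 2 * inner x d + q\<^sup>2"
    by (simp add: p_def q_def power2_norm_eq_inner inner_add inner_commute)
  also have "\<dots> = (1 - s) * (p - q)\<^sup>2 + s * (p + q)\<^sup>2"
    by (simp add: xd power2_eq_square algebra_simps)
  finally have main: "cosh (norm (x + d)) \<le> (1 - s) * cosh (p - q) + s * cosh (p + q)"
    using s by (intro cosh_convex_in_square)
  \<comment> \<open>In the addition formulas for \<open>cosh (p + q)\<close> and
    \<open>cosh (p - q)\<close>, write \<open>sinh q\<close> as \<open>q + (sinh q - q)\<close> and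
    bound \<open>sinh p\<close> and \<open>- sinh p\<close> by \<open>cosh p\<close> in the
    remainder. The same \<open>K\<close> serves both signs.\<close>
  define K where "K = cosh p * (cosh q + sinh q - q)"
  have sq: "sinh q - q \<ge> 0" using le_sinh[OF pq(2)] by simp
  have "sinh p \<le> cosh p" "- sinh p \<le> cosh p"
    using cosh_plus_sinh[of p] cosh_minus_sinh[of p] exp_gt_zero[of p] exp_gt_zero[of "- p"]
    by linarith+
  from this[THEN mult_right_mono, OF sq] have "sinh p * (sinh q - q) \<le> cosh p * (sinh q - q)"
    "- sinh p * (sinh q - q) \<le> cosh p * (sinh q - q)"
    by simp_all
  then have "cosh (p + q) \<le> K + q * sinh p" "cosh (p - q) \<le> K - q * sinh p"
    by (simp_all add: K_def cosh_add cosh_diff algebra_simps)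
  then have "(1 - s) * cosh (p - q) + s * cosh (p + q)
      \<le> (1 - s) * (K - q * sinh p) + s * (K + q * sinh p)"
    using s by (intro add_mono mult_left_mono) auto
  also have "\<dots> = K + (2 * s - 1) * q * sinh p"
    by (simp add: algebra_simps)
  also have "(2 * s - 1) * q * sinh p = sinh p / p * inner x d"
    by (cases "p = 0") (simp_all add: xd)
  also have "K = cosh p + cosh p * (exp q - 1 - q)"
    by (simp add: K_def cosh_plus_sinh algebra_simps flip: cosh_plus_sinh)
  finally show ?thesis using main by (simp add: p_def q_def)
qed

text \<open>For nonnegative \<open>x\<close>, \<open>(exp x - 1 - x) / x^2\<close> is increasing
  because its Taylor coefficients are nonnegative. The product form also covers
  \<open>x = 0\<close>.\<close>

lemma exp_remainder_quadratic_le: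
  fixes x c :: real
  assumes "0 \<le> x" "x \<le> c" "0 < c"
  shows "exp x - 1 - x \<le> x\<^sup>2 * ((exp c - 1 - c) / c\<^sup>2)"
proof -
  have eq: "(\<lambda>n. inverse (fact (n + 2)) * y ^ (n + 2)) sums (exp y - 1 - y)" for y :: real
    using exp_first_two_terms[of y] summable_sums[OF summable_ignore_initial_segment[OF summable_exp[of y], of 2]]
    by simp
  have "inverse (fact (n + 2)) * x ^ (n + 2)
      \<le> (x\<^sup>2 / c\<^sup>2) * (inverse (fact (n + 2)) * c ^ (n + 2))" for n
  proof -
    have "x ^ n \<le> c ^ n" using assms by (intro power_mono)
    then have "x\<^sup>2 * x ^ n * inverse (fact (n + 2)) \<le> x\<^sup>2 * c ^ n * inverse (fact (n + 2))"
      by (intro mult_right_mono mult_left_mono) auto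
    then show ?thesis using assms by (simp add: power_add mult_ac power2_eq_square)
  qed
  from sums_le[OF this eq sums_mult[OF eq]] show ?thesis by simp
qed

lemma hfun_strict_mono:
  assumes "0 \<le> u" "u < v"
  shows "hfun u < hfun v"
proof (rule DERIV_pos_imp_increasing_open[OF assms(2)])
  fix x assume "u < x" "x < v"
  then show "\<exists>y. (hfun has_real_derivative y) (at x) \<and> 0 < y"
    using assms unfolding hfun_def
    by (intro exI[of _ "ln (1 + x)"]) (auto intro!: derivative_eq_intros)
next
  show "continuous_on {u..v} hfun"
    using assms unfolding hfun_def by (auto intro!: continuous_intros)
qed

text \<open>Justifies the definite description: the intermediate value theorem gives existence,
  strict monotonicity uniqueness.\<close>

lemma hfun_inv:
  assumes "0 \<le> y"
  shows "0 \<le> hfun_inv y" "hfun (hfun_inv y) = y"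
proof -
  \<comment> \<open>Large enough that \<open>ln (1 + v)\<close> is at least 2, so
    \<open>hfun v\<close> is at least \<open>2 * (1 + v) - v\<close>, which exceeds
    \<open>y\<close>.\<close>
  define v where "v = exp 2 + y"
  have v: "0 \<le> v" using assms by (simp add: v_def)
  have ln: "2 \<le> ln (1 + v)"
    using assms ln_mono[of "exp 2" "1 + v"] by (simp add: v_def)
  have "(1 + v) * 2 \<le> (1 + v) * ln (1 + v)"
    using v by (intro mult_left_mono ln) auto
  moreover have "y \<le> v" by (simp add: v_def)
  ultimately have "y \<le> hfun v" using v by (simp add: hfun_def)
  moreover have "continuous_on {0..v} hfun"
    unfolding hfun_def by (auto intro!: continuous_intros)
  moreover have "hfun 0 \<le> y" using assms by (simp add: hfun_def)
  ultimately obtain u where u: "0 \<le> u" "hfun u = y"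
    using IVT'[of hfun 0 y v] v by auto
  have "0 \<le> hfun_inv y \<and> hfun (hfun_inv y) = y"
    unfolding hfun_inv_def
  proof (rule theI)
    show "0 \<le> u \<and> hfun u = y" using u by simp
    show "x = u" if "0 \<le> x \<and> hfun x = y" for x
      using that u hfun_strict_mono[of x u] hfun_strict_mono[of u x] by (cases x u rule: linorder_cases) auto
  qed
  then show "0 \<le> hfun_inv y" "hfun (hfun_inv y) = y" by auto
qed

section \<open>Inverse square roots of coercive operators\<close>

text \<open>The sort of the Hilbert space is not below \<open>banach\<close>, so the library test does not apply.\<close>
lemma summable_of_norm_le:
  fixes f :: "nat \<Rightarrow> 'h::{real_normed_vector, complete_space}"
  assumes "summable g" "\<And>k. norm (f k) \<le> g k"
  shows "summable f"
proof -
  have "Cauchy (\<lambda>n. \<Sum>k<n. f k)"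
  proof (rule metric_CauchyI)
    fix e :: real assume "0 < e"
    from summable_Cauchy[THEN iffD1, OF assms(1), rule_format, OF this]
    obtain N where N: "\<And>m n. m \<ge> N \<Longrightarrow> norm (sum g {m..<n}) < e" by auto
    have tail: "norm ((\<Sum>k<n. f k) - (\<Sum>k<m. f k)) < e" if "N \<le> m" "m \<le> n" for m n
    proof -
      have "(\<Sum>k<n. f k) - (\<Sum>k<m. f k) = sum f {m..<n}"
        using that sum_diff_nat_ivl[of 0 m n f] by (simp add: atLeast0LessThan)
      moreover have "norm (sum f {m..<n}) \<le> sum g {m..<n}"
        by (rule sum_norm_le) (use assms in auto)
      ultimately show ?thesis using N[OF that(1), of n] by simp
    qed
    show "\<exists>N. \<forall>m\<ge>N. \<forall>n\<ge>N. dist (\<Sum>k<m. f k) (\<Sum>k<n. f k) < e"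
    proof (intro exI[of _ N] allI impI)
      fix m n assume "m \<ge> N" "n \<ge> N"
      then show "dist (\<Sum>k<m. f k) (\<Sum>k<n. f k) < e"
        using tail[of m n] tail[of n m] by (cases "m \<le> n") (auto simp: dist_norm norm_minus_commute)
    qed
  qed
  then show ?thesis
    by (simp add: summable_iff_convergent Cauchy_convergent_iff)
qed

text \<open>The Taylor coefficients of \<open>(1 - x) powr (-1/2)\<close>.\<close>
definition inv_sqrt_coeff :: "nat \<Rightarrow> real" where
  "inv_sqrt_coeff k = pochhammer (1/2) k / fact k"

lemma inv_sqrt_coeff_nonneg: "0 \<le> inv_sqrt_coeff k"
  by (simp add: inv_sqrt_coeff_def pochhammer_nonneg)

text \<open>The square of \<open>(1 - x) powr (-1/2)\<close> is the geometric series, with all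
  coefficients 1. Formally this is Vandermonde's identity with both upper arguments
  \<open>-1/2\<close>.\<close>

lemma inv_sqrt_coeff_convolution:
  "(\<Sum>i\<le>k. inv_sqrt_coeff i * inv_sqrt_coeff (k - i)) = 1"
proof -
  have c: "(- (1/2) gchoose i) = (-1) ^ i * inv_sqrt_coeff i" for i
    by (simp add: gbinomial_pochhammer inv_sqrt_coeff_def)
  have "(-1) ^ k = (- 1 :: real) gchoose k"
    by (simp add: gbinomial_pochhammer pochhammer_fact[symmetric])
  also have "\<dots> = (\<Sum>i\<in>{0..k}. (- (1/2) gchoose i) * (- (1/2) gchoose (k - i)))"
    by (subst gbinomial_Vandermonde) simp
  also have "\<dots> = (\<Sum>i\<in>{0..k}. (-1) ^ k * (inv_sqrt_coeff i * inv_sqrt_coeff (k - i)))"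
    by (intro sum.cong refl) (simp add: c mult_ac flip: power_add)
  finally have "(-1) ^ k = (-1) ^ k * (\<Sum>i\<le>k. inv_sqrt_coeff i * inv_sqrt_coeff (k - i))"
    by (simp add: sum_distrib_left atLeast0AtMost)
  then show ?thesis by simp
qed

text \<open>The coefficient is the summand \<open>i = 0\<close> of a convolution of nonnegative
  terms that sums to 1.\<close>

lemma inv_sqrt_coeff_le_1: "inv_sqrt_coeff k \<le> 1"
proof -
  have "inv_sqrt_coeff 0 * inv_sqrt_coeff (k - 0)
      \<le> (\<Sum>i\<le>k. inv_sqrt_coeff i * inv_sqrt_coeff (k - i))"
    by (rule member_le_sum) (auto simp: inv_sqrt_coeff_nonneg)
  then show ?thesis by (simp add: inv_sqrt_coeff_convolution) (simp add: inv_sqrt_coeff_def)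
qed

lemma funpow_commute_apply:
  assumes "\<And>x. f (g x) = g (f x)"
  shows "(f ^^ k) (g x) = g ((f ^^ k) x)"
  by (induction k) (simp_all add: assms)

section \<open>The binomial series for the inverse square root of \<open>I - D\<close>\<close>

locale positive_contraction =
  fixes D :: "'h::{real_inner, complete_space} \<Rightarrow> 'h" and q :: real
  assumes lin: "linear D" and q_less_1: "q < 1" and q_nonneg: "0 \<le> q"
    and norm_le: "norm (D x) \<le> q * norm x"
    and sym: "inner (D x) y = inner x (D y)"
    and pos: "0 \<le> inner (D x) x"
begin

lemma pow_linear: "linear (D ^^ k)"
proof (induction k)
  case 0
  show ?case by (simp add: linear_iff)
next
  case (Suc k)
  then show ?case by (simp only: funpow.simps) (rule linear_compose[OF _ lin])
qed

lemma pow_norm_le: "norm ((D ^^ k) x) \<le> q ^ k * norm x"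
proof (induction k)
  case (Suc k)
  have "norm ((D ^^ Suc k) x) \<le> q * norm ((D ^^ k) x)" by (simp add: norm_le)
  also have "\<dots> \<le> q * (q ^ k * norm x)" by (intro mult_left_mono Suc q_nonneg)
  finally show ?case by (simp add: mult_ac)
qed simp

lemma pow_sym: "inner ((D ^^ k) x) y = inner x ((D ^^ k) y)"
  by (induction k arbitrary: x y) (simp_all add: sym funpow_commute_apply)

text \<open>Half of the factors move across the inner product, which leaves a squared norm for even
  \<open>k\<close> and the quadratic form of \<open>D\<close> for odd \<open>k\<close>.\<close>

lemma pow_pos: "0 \<le> inner ((D ^^ k) x) x"
proof -
  define j where "j = k div 2"
  have "k = j + j \<or> k = j + Suc j" by (auto simp: j_def)
  then show ?thesis
  proof
    assume "k = j + j"
    then have "inner ((D ^^ k) x) x = inner ((D ^^ j) x) ((D ^^ j) x)"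
      by (simp only: funpow_add o_apply pow_sym)
    then show ?thesis by simp
  next
    assume "k = j + Suc j"
    then have "inner ((D ^^ k) x) x = inner (D ((D ^^ j) x)) ((D ^^ j) x)"
      by (simp only: funpow_add o_apply pow_sym funpow.simps)
    then show ?thesis by (simp add: pos)
  qed
qed

text \<open>The binomial series of \<open>(I - D)^(-1/2)\<close>, dominated by a geometric series in
  \<open>q\<close>.\<close>

definition root :: "'h \<Rightarrow> 'h" where
  "root x = (\<Sum>k. inv_sqrt_coeff k *\<^sub>R (D ^^ k) x)"

lemma term_norm_le: "norm (inv_sqrt_coeff k *\<^sub>R (D ^^ k) x) \<le> q ^ k * norm x"
proof -
  have "norm (inv_sqrt_coeff k *\<^sub>R (D ^^ k) x) = inv_sqrt_coeff k * norm ((D ^^ k) x)"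
    by (simp add: inv_sqrt_coeff_nonneg)
  also have "\<dots> \<le> 1 * (q ^ k * norm x)"
    by (intro mult_mono inv_sqrt_coeff_le_1 pow_norm_le) auto
  finally show ?thesis by simp
qed

lemma geo_sums: "(\<lambda>k. q ^ k * c) sums (1 / (1 - q) * c)"
  using q_nonneg q_less_1 by (intro sums_mult2 geometric_sums) auto

lemma root_sums: "(\<lambda>k. inv_sqrt_coeff k *\<^sub>R (D ^^ k) x) sums root x"
  unfolding root_def
  by (intro summable_sums summable_of_norm_le[OF _ term_norm_le] sums_summable[OF geo_sums])

text \<open>Uniformity in \<open>N\<close> gives boundedness of \<open>root\<close> and lets the
  partial sums act on a convergent sequence when \<open>root\<close> is iterated.\<close>

lemma partial_norm_le: "norm (\<Sum>k<N. inv_sqrt_coeff k *\<^sub>R (D ^^ k) x) \<le> 1 / (1 - q) * norm x"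
proof -
  have "norm (\<Sum>k<N. inv_sqrt_coeff k *\<^sub>R (D ^^ k) x) \<le> (\<Sum>k<N. q ^ k * norm x)"
    by (rule sum_norm_le) (rule term_norm_le)
  also have "\<dots> \<le> (\<Sum>k. q ^ k * norm x)"
    using q_nonneg by (intro sum_le_suminf sums_summable[OF geo_sums]) auto
  also have "\<dots> = 1 / (1 - q) * norm x" by (rule sums_unique[OF geo_sums, symmetric])
  finally show ?thesis .
qed

lemma root_bounded_linear: "bounded_linear root"
proof
  show "root (x + y) = root x + root y" for x y
  proof (rule sums_unique2[OF root_sums])
    show "(\<lambda>k. inv_sqrt_coeff k *\<^sub>R (D ^^ k) (x + y)) sums (root x + root y)"
      using sums_add[OF root_sums[of x] root_sums[of y]]
      by (simp add: linear_add[OF pow_linear] scaleR_add_right)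
  qed
  show "root (r *\<^sub>R x) = r *\<^sub>R root x" for r x
  proof (rule sums_unique2[OF root_sums])
    show "(\<lambda>k. inv_sqrt_coeff k *\<^sub>R (D ^^ k) (r *\<^sub>R x)) sums (r *\<^sub>R root x)"
      using sums_scaleR_right[OF root_sums[of x], of r]
      by (simp add: linear_scale[OF pow_linear] mult_ac)
  qed
  have "norm (root x) \<le> norm x * (1 / (1 - q))" for x
    using LIMSEQ_le_const2[OF tendsto_norm[OF root_sums[of x, unfolded sums_def]]]
      partial_norm_le[of x] by (auto simp: mult_ac)
  then show "\<exists>K. \<forall>x. norm (root x) \<le> norm x * K" by blast
qed

lemma root_sym: "inner (root x) y = inner x (root y)"
proof -
  have "(\<lambda>k. inner (inv_sqrt_coeff k *\<^sub>R (D ^^ k) x) y) sums inner (root x) y"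
    by (rule bounded_linear.sums[OF bounded_linear_inner_left root_sums])
  moreover have "(\<lambda>k. inner x (inv_sqrt_coeff k *\<^sub>R (D ^^ k) y)) sums inner x (root y)"
    by (rule bounded_linear.sums[OF bounded_linear_inner_right root_sums])
  ultimately show ?thesis by (simp add: pow_sym sums_unique2)
qed

lemma root_pos: "0 \<le> inner (root x) x"
proof (rule sums_le)
  show "(\<lambda>k. inner (inv_sqrt_coeff k *\<^sub>R (D ^^ k) x) x) sums inner (root x) x"
    by (rule bounded_linear.sums[OF bounded_linear_inner_left root_sums])
  show "(\<lambda>k. 0) sums (0::real)" by simp
qed (simp add: pow_pos inv_sqrt_coeff_nonneg)

text \<open>\<open>T\<close> passes through the series term by term. Uniqueness of the inverse
  square root rests on this.\<close>

lemma root_commute: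
  assumes "bounded_linear T" "\<And>x. T (D x) = D (T x)"
  shows "root (T x) = T (root x)"
proof (rule sums_unique2[OF root_sums])
  interpret T: bounded_linear T by fact
  show "(\<lambda>k. inv_sqrt_coeff k *\<^sub>R (D ^^ k) (T x)) sums T (root x)"
    using T.sums[OF root_sums[of x]] assms(2)
    by (simp add: T.scaleR funpow_commute_apply)
qed

text \<open>The Cauchy product of the binomial series with itself is the Neumann series of
  \<open>I - D\<close>. The error is controlled by the same product for scalars, with
  \<open>q\<close> in place of \<open>D\<close>.\<close>

lemma root_root_tendsto: "(\<lambda>N. \<Sum>k<N. (D ^^ k) x) \<longlonglongrightarrow> root (root x)"
proof -
  define P where "P N x = (\<Sum>k<N. inv_sqrt_coeff k *\<^sub>R (D ^^ k) x)" for N x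
  have P: "(\<lambda>N. P N x) \<longlonglongrightarrow> root x" for x
    unfolding P_def using root_sums[of x] by (simp add: sums_def)
  have Plin: "P N (x - y) = P N x - P N y" for N x y
    by (simp add: P_def linear_diff[OF pow_linear] scaleR_diff_right sum_subtractf)
  \<comment> \<open>Operator and argument vary together with \<open>N\<close>; the uniform bound on
    \<open>P N\<close> handles the argument's error.\<close>
  have "(\<lambda>N. P N (P N x - root x)) \<longlonglongrightarrow> 0"
  proof (rule Lim_null_comparison)
    show "\<forall>\<^sub>F N in sequentially. norm (P N (P N x - root x)) \<le> 1 / (1 - q) * norm (P N x - root x)"
      unfolding P_def by (intro always_eventually allI partial_norm_le)
    show "(\<lambda>N. 1 / (1 - q) * norm (P N x - root x)) \<longlonglongrightarrow> 0"
      using P[of x] by (intro tendsto_mult_right_zero tendsto_norm_zero) (simp add: LIM_zero)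
  qed
  from tendsto_add[OF this P[of "root x"]]
  have PP: "(\<lambda>N. P N (P N x)) \<longlonglongrightarrow> root (root x)" by (simp add: Plin)
  define \<alpha> where "\<alpha> k = inv_sqrt_coeff k * q ^ k" for k
  have \<alpha>: "0 \<le> \<alpha> k" "\<alpha> k \<le> q ^ k" for k
    using q_nonneg inv_sqrt_coeff_nonneg[of k] inv_sqrt_coeff_le_1[of k]
    by (auto simp: \<alpha>_def intro: mult_left_le_one_le)
  have sm: "summable \<alpha>"
    by (rule summable_comparison_test'[where g = "\<lambda>k. q ^ k"])
      (use \<alpha> q_nonneg q_less_1 in \<open>auto intro: summable_geometric\<close>)
  have conv: "(\<Sum>i\<le>k. \<alpha> i * \<alpha> (k - i)) = q ^ k" for k
  proof -
    have "(\<Sum>i\<le>k. \<alpha> i * \<alpha> (k - i)) = (\<Sum>i\<le>k. q ^ k * (inv_sqrt_coeff i * inv_sqrt_coeff (k - i)))"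
      by (intro sum.cong) (auto simp: \<alpha>_def mult_ac simp flip: power_add)
    then show ?thesis by (simp add: inv_sqrt_coeff_convolution flip: sum_distrib_left)
  qed
  have "(\<lambda>k. \<Sum>i\<le>k. \<alpha> i * \<alpha> (k - i)) sums (suminf \<alpha> * suminf \<alpha>)"
    using sm \<alpha> by (intro Cauchy_product_sums) auto
  then have geo: "(\<lambda>N. \<Sum>k<N. q ^ k) \<longlonglongrightarrow> suminf \<alpha> * suminf \<alpha>"
    by (simp add: conv sums_def)
  \<comment> \<open>The product of partial sums runs over a square of index pairs, the Neumann
    partial sum over the triangle \<open>i + j < N\<close>. As the coefficients are nonnegative, the
    norm of the rest is at most its scalar counterpart.\<close>
  have diff: "norm (P N (P N x) - (\<Sum>k<N. (D ^^ k) x))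
      \<le> ((\<Sum>k<N. \<alpha> k) * (\<Sum>k<N. \<alpha> k) - (\<Sum>k<N. q ^ k)) * norm x" for N
  proof -
    let ?Q = "{..<N} \<times> {..<N}" and ?T = "{(i, j). i + j < N}"
    let ?f = "\<lambda>i j. (inv_sqrt_coeff i * inv_sqrt_coeff j) *\<^sub>R (D ^^ (i + j)) x"
    have TQ: "?T \<subseteq> ?Q" by auto
    have "P N (P N x) = (\<Sum>i<N. \<Sum>j<N. ?f i j)"
      by (simp add: P_def linear_sum[OF pow_linear] linear_scale[OF pow_linear] scaleR_sum_right funpow_add)
    also have "\<dots> = (\<Sum>(i, j)\<in>?Q. ?f i j)" by (rule sum.cartesian_product)
    finally have 1: "P N (P N x) = (\<Sum>(i, j)\<in>?Q. ?f i j)" .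
    have "(\<Sum>(i, j)\<in>?T. ?f i j) = (\<Sum>k<N. \<Sum>i\<le>k. ?f i (k - i))"
      by (rule sum.triangle_reindex)
    also have "\<dots> = (\<Sum>k<N. (\<Sum>i\<le>k. inv_sqrt_coeff i * inv_sqrt_coeff (k - i)) *\<^sub>R (D ^^ k) x)"
      by (simp add: scaleR_sum_left)
    finally have 2: "(\<Sum>(i, j)\<in>?T. ?f i j) = (\<Sum>k<N. (D ^^ k) x)"
      by (simp add: inv_sqrt_coeff_convolution)
    have 3: "(\<Sum>k<N. \<alpha> k) * (\<Sum>k<N. \<alpha> k) = (\<Sum>(i, j)\<in>?Q. \<alpha> i * \<alpha> j)"
      by (simp add: sum_product sum.cartesian_product)
    have "(\<Sum>(i, j)\<in>?T. \<alpha> i * \<alpha> j) = (\<Sum>k<N. \<Sum>i\<le>k. \<alpha> i * \<alpha> (k - i))"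
      by (rule sum.triangle_reindex)
    then have 4: "(\<Sum>(i, j)\<in>?T. \<alpha> i * \<alpha> j) = (\<Sum>k<N. q ^ k)" by (simp add: conv)
    have "P N (P N x) - (\<Sum>k<N. (D ^^ k) x) = (\<Sum>(i, j)\<in>?Q - ?T. ?f i j)"
      unfolding 1 2[symmetric] using TQ by (subst sum_diff) auto
    also have "norm \<dots> \<le> (\<Sum>(i, j)\<in>?Q - ?T. \<alpha> i * \<alpha> j * norm x)"
    proof (rule sum_norm_le)
      fix p assume "p \<in> ?Q - ?T"
      obtain i j where p: "p = (i, j)" by fastforce
      have "norm (?f i j) = inv_sqrt_coeff i * inv_sqrt_coeff j * norm ((D ^^ (i + j)) x)"
        by (simp add: inv_sqrt_coeff_nonneg)
      also have "\<dots> \<le> inv_sqrt_coeff i * inv_sqrt_coeff j * (q ^ (i + j) * norm x)"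
        by (intro mult_left_mono pow_norm_le mult_nonneg_nonneg inv_sqrt_coeff_nonneg)
      finally show "norm (case p of (i, j) \<Rightarrow> ?f i j) \<le> (case p of (i, j) \<Rightarrow> \<alpha> i * \<alpha> j * norm x)"
        by (simp add: p \<alpha>_def power_add mult_ac)
    qed
    also have "\<dots> = (\<Sum>(i, j)\<in>?Q - ?T. \<alpha> i * \<alpha> j) * norm x"
      by (simp add: sum_distrib_right case_prod_unfold)
    also have "(\<Sum>(i, j)\<in>?Q - ?T. \<alpha> i * \<alpha> j)
        = (\<Sum>k<N. \<alpha> k) * (\<Sum>k<N. \<alpha> k) - (\<Sum>k<N. q ^ k)"
      unfolding 3 4[symmetric] using TQ by (subst sum_diff) auto
    finally show ?thesis .
  qed
  have "(\<lambda>N. P N (P N x) - (\<Sum>k<N. (D ^^ k) x)) \<longlonglongrightarrow> 0"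
  proof (rule Lim_null_comparison)
    show "\<forall>\<^sub>F N in sequentially. norm (P N (P N x) - (\<Sum>k<N. (D ^^ k) x))
        \<le> ((\<Sum>k<N. \<alpha> k) * (\<Sum>k<N. \<alpha> k) - (\<Sum>k<N. q ^ k)) * norm x"
      using diff by simp
    have "(\<lambda>N. ((\<Sum>k<N. \<alpha> k) * (\<Sum>k<N. \<alpha> k) - (\<Sum>k<N. q ^ k)) * norm x)
        \<longlonglongrightarrow> (suminf \<alpha> * suminf \<alpha> - suminf \<alpha> * suminf \<alpha>) * norm x"
      using summable_LIMSEQ[OF sm] geo by (intro tendsto_intros)
    then show "(\<lambda>N. ((\<Sum>k<N. \<alpha> k) * (\<Sum>k<N. \<alpha> k) - (\<Sum>k<N. q ^ k)) * norm x) \<longlonglongrightarrow> 0"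
      by simp
  qed
  from tendsto_diff[OF PP this] show ?thesis by simp
qed

text \<open>Applying \<open>I - D\<close> to the Neumann partial sums telescopes to
  \<open>x - (D ^^ N) x\<close>, and the power tends to 0.\<close>

lemma root_root_inverse: "root (root x) - D (root (root x)) = x"
proof -
  have bl: "bounded_linear D"
    using lin norm_le by (intro bounded_linear_intro[where K = q])
      (auto simp: linear_add linear_scale mult_ac)
  have "(\<lambda>N. (\<Sum>k<N. (D ^^ k) x) - D (\<Sum>k<N. (D ^^ k) x)) \<longlonglongrightarrow> root (root x) - D (root (root x))"
    by (intro tendsto_diff root_root_tendsto bounded_linear.tendsto[OF bl])
  moreover have "(\<Sum>k<N. (D ^^ k) x) - D (\<Sum>k<N. (D ^^ k) x) = x - (D ^^ N) x" for N
  proof (induction N)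
    case (Suc N)
    then show ?case by (simp add: linear_add[OF lin] add_diff_add)
  qed (simp add: linear_0[OF lin])
  moreover have "(\<lambda>N. x - (D ^^ N) x) \<longlonglongrightarrow> x - 0"
  proof (intro tendsto_diff tendsto_const, rule Lim_null_comparison)
    show "\<forall>\<^sub>F N in sequentially. norm ((D ^^ N) x) \<le> q ^ N * norm x"
      using pow_norm_le by simp
    show "(\<lambda>N. q ^ N * norm x) \<longlonglongrightarrow> 0"
      using q_nonneg q_less_1 by (intro tendsto_mult_left_zero LIMSEQ_power_zero) auto
  qed
  ultimately show ?thesis using LIMSEQ_unique by fastforce
qed

end

section \<open>Existence and uniqueness of the inverse square root\<close>

locale coercive_operator =
  fixes A :: "'h::{real_inner, complete_space} \<Rightarrow> 'h" and \<rho> :: real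
  assumes bl: "bounded_linear A" and sym: "inner (A x) y = inner x (A y)"
    and rho_pos: "0 < \<rho>" and coercive: "\<rho> * (norm x)\<^sup>2 \<le> inner (A x) x"
begin

text \<open>The predicate under the definite description in \<open>inv_sqrt_op\<close>.\<close>

definition is_inv_sqrt :: "('h \<Rightarrow> 'h) \<Rightarrow> bool" where
  "is_inv_sqrt S \<longleftrightarrow> bounded_linear S \<and> (\<forall>x y. inner (S x) y = inner x (S y))
     \<and> (\<forall>x. 0 \<le> inner (S x) x) \<and> (\<forall>x. S (S (A x)) = x) \<and> (\<forall>x. A (S (S x)) = x)"

text \<open>Writing \<open>A\<close> as \<open>\<kappa>\<close> times \<open>I - D\<close> with a
  positive contraction \<open>D\<close> reduces the claim to the binomial series. The commutation
  clause is kept for the uniqueness proof.\<close>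

lemma commuting_inv_sqrt_exists:
  "\<exists>S. is_inv_sqrt S \<and> (\<forall>T. bounded_linear T \<longrightarrow> (\<forall>x. T (A x) = A (T x)) \<longrightarrow> (\<forall>x. S (T x) = T (S x)))"
proof -
  interpret A: bounded_linear A by (rule bl)
  obtain K0 where K0: "\<And>x. norm (A x) \<le> norm x * K0" using A.bounded by blast
  define K where "K = max K0 \<rho>"
  have K: "norm (A x) \<le> K * norm x" for x
  proof -
    have "norm x * K0 \<le> norm x * K" by (intro mult_left_mono) (auto simp: K_def)
    with K0[of x] show ?thesis by (simp add: mult_ac)
  qed
  have Kr: "\<rho> \<le> K" "0 < K" using rho_pos by (auto simp: K_def)
  \<comment> \<open>This scaling minimises the bound
    \<open>1 - 2 * \<rho> / \<kappa> + K^2 / \<kappa>^2\<close> on the squared norm ratio of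
    \<open>D\<close>; the minimum is \<open>q^2\<close>. As \<open>K\<close> is at least
    \<open>\<rho>\<close>, also \<open>\<kappa>\<close> is at least \<open>K\<close>, which makes
    \<open>D\<close> positive.\<close>
  define \<kappa> where "\<kappa> = K\<^sup>2 / \<rho>"
  define D where "D x = x - (1 / \<kappa>) *\<^sub>R A x" for x
  define q where "q = sqrt (1 - \<rho>\<^sup>2 / K\<^sup>2)"
  have \<kappa>: "0 < \<kappa>" using Kr rho_pos by (simp add: \<kappa>_def)
  have K\<kappa>: "K \<le> \<kappa>" using Kr rho_pos by (simp add: \<kappa>_def field_simps power2_eq_square)
  have q2: "0 \<le> 1 - \<rho>\<^sup>2 / K\<^sup>2" using Kr rho_pos by (simp add: field_simps power_mono)
  interpret D: positive_contraction D q
  proof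
    show "D (x + y) = D x + D y" "D (r *\<^sub>R x) = r *\<^sub>R D x" for x y r
      by (simp_all add: D_def A.add A.scaleR algebra_simps)
    show "q < 1" using Kr rho_pos by (simp add: q_def)
    show "0 \<le> q" using q2 by (simp add: q_def)
    show "inner (D x) y = inner x (D y)" for x y
      by (simp add: D_def inner_diff sym)
    show "0 \<le> inner (D x) x" for x
    proof -
      have "inner (A x) x \<le> norm (A x) * norm x" by (rule norm_cauchy_schwarz)
      also have "\<dots> \<le> K * norm x * norm x" by (intro mult_right_mono K) auto
      also have "\<dots> \<le> \<kappa> * norm x * norm x" by (intro mult_right_mono K\<kappa>) auto
      finally have "inner (A x) x \<le> \<kappa> * inner x x" by (simp add: power2_norm_eq_inner[symmetric] power2_eq_square mult_ac)
      then show ?thesis using \<kappa> by (simp add: D_def inner_diff field_simps)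
    qed
    show "norm (D x) \<le> q * norm x" for x
    proof (rule power2_le_imp_le)
      have "(norm (D x))\<^sup>2 = (norm x)\<^sup>2 - 2 / \<kappa> * inner (A x) x + (norm (A x))\<^sup>2 / \<kappa>\<^sup>2"
        unfolding D_def power2_norm_eq_inner
        by (simp add: inner_diff inner_commute power2_eq_square algebra_simps)
      also have "\<dots> \<le> (norm x)\<^sup>2 - 2 / \<kappa> * (\<rho> * (norm x)\<^sup>2) + (K * norm x)\<^sup>2 / \<kappa>\<^sup>2"
        using \<kappa> by (intro add_mono diff_mono mult_left_mono divide_right_mono coercive power_mono K) auto
      also have "\<dots> = (1 - \<rho>\<^sup>2 / K\<^sup>2) * (norm x)\<^sup>2"
        using Kr rho_pos by (simp add: \<kappa>_def field_simps power2_eq_square)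
      also have "\<dots> = (q * norm x)\<^sup>2" using q2 by (simp add: q_def power_mult_distrib)
      finally show "(norm (D x))\<^sup>2 \<le> (q * norm x)\<^sup>2" .
      show "0 \<le> q * norm x" using q2 by (simp add: q_def)
    qed
  qed
  define S where "S x = (1 / sqrt \<kappa>) *\<^sub>R D.root x" for x
  interpret R: bounded_linear D.root by (rule D.root_bounded_linear)
  have SS: "S (S x) = (1 / \<kappa>) *\<^sub>R D.root (D.root x)" for x
    using \<kappa> by (simp add: S_def R.scaleR)
  have Aeq: "A x = \<kappa> *\<^sub>R (x - D x)" for x using \<kappa> by (simp add: D_def)
  have comm: "S (T x) = T (S x)" if T: "bounded_linear T" "\<And>x. T (A x) = A (T x)" for T x
  proof -
    interpret T: bounded_linear T by fact
    have "T (D x) = D (T x)" for x by (simp add: D_def T.diff T.scaleR T)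
    then show ?thesis by (simp add: S_def T.scaleR D.root_commute[OF T(1)])
  qed
  have ASS: "A (S (S x)) = x" for x
  proof -
    have "A (S (S x)) = (1 / \<kappa>) *\<^sub>R A (D.root (D.root x))" by (simp add: SS A.scaleR)
    also have "\<dots> = x" using \<kappa> by (simp add: Aeq D.root_root_inverse)
    finally show ?thesis .
  qed
  have "is_inv_sqrt S"
    unfolding is_inv_sqrt_def
  proof (intro conjI allI)
    show "bounded_linear S"
      unfolding S_def by (intro bounded_linear_const_scaleR D.root_bounded_linear)
    show "inner (S x) y = inner x (S y)" for x y by (simp add: S_def D.root_sym)
    show "0 \<le> inner (S x) x" for x using \<kappa> by (simp add: S_def D.root_pos)
    show "A (S (S x)) = x" for x by (rule ASS)
    show "S (S (A x)) = x" for x using ASS comm[OF bl] by simp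
  qed
  with comm show ?thesis by blast
qed

text \<open>Uniqueness: every inverse square root \<open>T\<close> commutes with \<open>A\<close>, hence with the one constructed
  above, \<open>S\<close>; then \<open>(S + T) (S - T) = 0\<close> and positivity forces \<open>S = T\<close>.\<close>
lemma is_inv_sqrt_inv_sqrt_op: "is_inv_sqrt (inv_sqrt_op A)"
proof -
  obtain S where S: "is_inv_sqrt S"
    and comm: "\<And>T x. bounded_linear T \<Longrightarrow> (\<And>x. T (A x) = A (T x)) \<Longrightarrow> S (T x) = T (S x)"
    using commuting_inv_sqrt_exists by blast
  interpret S: bounded_linear S using S by (simp add: is_inv_sqrt_def)
  have "is_inv_sqrt (THE S. is_inv_sqrt S)"
  proof (rule theI[of is_inv_sqrt, OF S])
    fix T assume T: "is_inv_sqrt T"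
    interpret T: bounded_linear T using T by (simp add: is_inv_sqrt_def)
    have TA: "T (A x) = A (T x)" for x
    proof -
      have "T (A x) = A (T (T (T (A x))))" "T (T (A x)) = x"
        using T unfolding is_inv_sqrt_def by metis+
      then show ?thesis by simp
    qed
    have ST: "S (T x) = T (S x)" for x by (rule comm[of T]) (rule T.bounded_linear_axioms TA)+
    have "S (S x) = T (T x)" for x
    proof -
      have "S (S x) = S (S (A (T (T x))))" using T by (simp add: is_inv_sqrt_def)
      also have "\<dots> = T (T x)" using S by (simp add: is_inv_sqrt_def)
      finally show ?thesis .
    qed
    then have sq: "S (S x - T x) + T (S x - T x) = 0" for x
      by (simp add: S.diff T.diff ST)
    show "T = S"
    proof
      fix x
      define y where "y = S x - T x"
      have "inner (S y) y + inner (T y) y = 0"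
        using sq[of x] by (simp add: y_def flip: inner_add_left)
      moreover have "0 \<le> inner (S y) y" "0 \<le> inner (T y) y"
        using S T by (auto simp: is_inv_sqrt_def)
      ultimately have Sy: "inner (S y) y = 0" by simp
      define n b where "n = inner (S y) (S y)" and "b = inner (S (S y)) (S y)"
      have b: "0 \<le> b" using S unfolding b_def is_inv_sqrt_def by blast
      have Ssym: "inner (S x) z = inner x (S z)" for x z using S by (simp add: is_inv_sqrt_def)
      \<comment> \<open>The form of \<open>S\<close> is nonnegative and vanishes at
        \<open>y\<close>, so its derivative at \<open>y\<close> in direction \<open>S y\<close>,
        namely \<open>2 * n\<close>, must be 0.\<close>
      have quad: "0 \<le> 2 * t * n + t\<^sup>2 * b" for t
      proof -
        have "0 \<le> inner (S (y + t *\<^sub>R S y)) (y + t *\<^sub>R S y)"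
          using S unfolding is_inv_sqrt_def by blast
        also have "\<dots> = inner (S y) y + t * inner (S y) (S y) + t * inner (S (S y)) y + t\<^sup>2 * b"
          by (simp add: S.add S.scaleR inner_add b_def power2_eq_square algebra_simps)
        also have "inner (S (S y)) y = n" by (simp add: n_def Ssym)
        finally show ?thesis by (simp add: Sy n_def)
      qed
      have "n = 0"
      proof (rule ccontr)
        assume "n \<noteq> 0"
        \<comment> \<open>The minimiser would be \<open>- n / b\<close>; the denominator
          \<open>b + 1\<close> avoids a case distinction at \<open>b = 0\<close> and still makes the
          value negative.\<close>
        have "0 \<le> 2 * (- n / (b + 1)) * n + (- n / (b + 1))\<^sup>2 * b" by (rule quad)
        then have "0 \<le> (2 * (- n / (b + 1)) * n + (- n / (b + 1))\<^sup>2 * b) * (b + 1)\<^sup>2"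
          by (intro mult_nonneg_nonneg) auto
        also have "\<dots> = - (n\<^sup>2 * (b + 2))"
        proof -
          have "(- n / (b + 1)) * (b + 1) = - n" using b by simp
          then show ?thesis by algebra
        qed
        finally have "n\<^sup>2 * (b + 2) \<le> 0" by simp
        moreover have "0 < b + 2" using b by simp
        ultimately show False using \<open>n \<noteq> 0\<close> zero_less_power2[of n] by (auto simp: mult_le_0_iff)
      qed
      then have "S y = 0" by (simp add: n_def)
      then have "y = A (S 0)" using S unfolding is_inv_sqrt_def by metis
      then show "T x = S x" 
        using linear_0[OF bounded_linear.linear[OF bl]] linear_0[OF S.linear] by (simp add: y_def)
    qed
  qed
  moreover have "inv_sqrt_op A = (THE S. is_inv_sqrt S)"
    by (simp add: inv_sqrt_op_def is_inv_sqrt_def)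
  ultimately show ?thesis by simp
qed

end

section \<open>Variational formula for the norm under the inverse square root\<close>

context coercive_operator
begin

lemma inv_sqrt_op_bounded_linear: "bounded_linear (inv_sqrt_op A)"
  and inv_sqrt_op_sym: "inner (inv_sqrt_op A x) y = inner x (inv_sqrt_op A y)"
  and A_inv_sqrt_op_twice: "A (inv_sqrt_op A (inv_sqrt_op A x)) = x"
  using is_inv_sqrt_inv_sqrt_op unfolding is_inv_sqrt_def by blast+

lemma norm_inv_sqrt_op_square:
  "(norm (inv_sqrt_op A m))\<^sup>2 = inner m (inv_sqrt_op A (inv_sqrt_op A m))"
  by (simp add: power2_norm_eq_inner inv_sqrt_op_sym)

text \<open>Together with the next lemma: the squared norm is the maximum of
  \<open>2 * inner m x - inner (A x) x\<close> over \<open>x\<close>, attained where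
  \<open>A z = m\<close>. Monotonicity and measurability both come from this formula.\<close>

lemma norm_inv_sqrt_op_attained:
  "(norm (inv_sqrt_op A m))\<^sup>2 = 2 * inner m z - inner (A z) z"
  if "z = inv_sqrt_op A (inv_sqrt_op A m)"
  unfolding norm_inv_sqrt_op_square that A_inv_sqrt_op_twice by simp

lemma norm_inv_sqrt_op_ge: "2 * inner m x - inner (A x) x \<le> (norm (inv_sqrt_op A m))\<^sup>2"
proof -
  interpret A: bounded_linear A by (rule bl)
  define z where "z = inv_sqrt_op A (inv_sqrt_op A m)"
  have Az: "A z = m" by (simp add: z_def A_inv_sqrt_op_twice)
  have "0 \<le> \<rho> * (norm (x - z))\<^sup>2" using rho_pos by simp
  also have "\<dots> \<le> inner (A (x - z)) (x - z)" by (rule coercive)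
  also have "\<dots> = inner (A x) x - 2 * inner m x + inner m z"
    by (simp add: A.diff inner_diff Az sym[of x z] inner_commute[of x m])
  finally show ?thesis by (simp add: norm_inv_sqrt_op_square z_def)
qed

text \<open>Testing the hypothesis at the solution \<open>z\<close> of \<open>A z = v\<close> gives
  \<open>(inner v z)^2 \<le> inner v z\<close>, and \<open>inner v z\<close> is the squared norm in
  question.\<close>

lemma norm_inv_sqrt_op_le_1:
  assumes "\<And>x. (inner v x)\<^sup>2 \<le> inner (A x) x"
  shows "norm (inv_sqrt_op A v) \<le> 1"
proof -
  define z where "z = inv_sqrt_op A (inv_sqrt_op A v)"
  have "(inner v z)\<^sup>2 \<le> inner v z"
    using assms[of z] by (simp add: z_def A_inv_sqrt_op_twice)
  then have "inner v z * inner v z \<le> inner v z * 1" by (simp add: power2_eq_square)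
  then have "inner v z \<le> 1"
    by (cases "0 < inner v z") (simp_all add: mult_le_cancel_left)
  then have "(norm (inv_sqrt_op A v))\<^sup>2 \<le> 1\<^sup>2"
    by (simp add: norm_inv_sqrt_op_square z_def)
  then show ?thesis by (rule power2_le_imp_le) simp
qed

end

text \<open>A larger operator lowers the functional being maximised; compare both at the maximiser
  for \<open>A'\<close>.\<close>

lemma norm_inv_sqrt_op_antimono:
  assumes "coercive_operator A \<rho>" "coercive_operator A' \<rho>'"
    and "\<And>x. inner (A x) x \<le> inner (A' x) x"
  shows "norm (inv_sqrt_op A' m) \<le> norm (inv_sqrt_op A m)"
proof (rule power2_le_imp_le)
  define z where "z = inv_sqrt_op A' (inv_sqrt_op A' m)"
  have "(norm (inv_sqrt_op A' m))\<^sup>2 = 2 * inner m z - inner (A' z) z"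
    by (rule coercive_operator.norm_inv_sqrt_op_attained[OF assms(2) z_def])
  also have "\<dots> \<le> 2 * inner m z - inner (A z) z" using assms(3)[of z] by simp
  also have "\<dots> \<le> (norm (inv_sqrt_op A m))\<^sup>2"
    by (rule coercive_operator.norm_inv_sqrt_op_ge[OF assms(1)])
  finally show "(norm (inv_sqrt_op A' m))\<^sup>2 \<le> (norm (inv_sqrt_op A m))\<^sup>2" .
qed simp

section \<open>The regularised operator and its measurability\<close>

lemma inner_regop: "inner (regop \<rho> X t w x) x = \<rho> * (norm x)\<^sup>2 + (\<Sum>i\<in>{1..t}. (inner (X i w) x)\<^sup>2)"
  by (simp add: regop_def Vop_def outer_def inner_add_left inner_sum_left power2_norm_eq_inner)
    (simp add: power2_eq_square)

lemma coercive_regop: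
  fixes X :: "nat \<Rightarrow> 'a \<Rightarrow> 'h::{real_inner, complete_space}"
  assumes "0 < \<rho>"
  shows "coercive_operator (regop \<rho> X t w) \<rho>"
proof
  show "regop \<rho> X t w (x + y) = regop \<rho> X t w x + regop \<rho> X t w y" for x y
    by (simp add: regop_def Vop_def outer_def inner_add_right scaleR_add_left scaleR_add_right sum.distrib)
  show "regop \<rho> X t w (r *\<^sub>R x) = r *\<^sub>R regop \<rho> X t w x" for r x
    by (simp add: regop_def Vop_def outer_def scaleR_add_right scaleR_sum_right mult_ac)
  show "\<exists>K. \<forall>x. norm (regop \<rho> X t w x) \<le> norm x * K"
  proof (intro exI allI)
    fix x
    have "norm (inner (X i w) x *\<^sub>R X i w) \<le> norm x * (norm (X i w))\<^sup>2" for i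
      using mult_right_mono[OF Cauchy_Schwarz_ineq2[of "X i w" x], of "norm (X i w)"]
      by (simp add: power2_eq_square mult_ac)
    then have "norm (Vop X t w x) \<le> (\<Sum>i\<in>{1..t}. norm x * (norm (X i w))\<^sup>2)"
      unfolding Vop_def outer_def by (rule sum_norm_le)
    then show "norm (regop \<rho> X t w x) \<le> norm x * (\<rho> + (\<Sum>i\<in>{1..t}. (norm (X i w))\<^sup>2))"
      unfolding regop_def using assms norm_triangle_ineq[of "\<rho> *\<^sub>R x" "Vop X t w x"]
      by (simp add: distrib_left sum_distrib_left mult_ac)
  qed
  show "inner (regop \<rho> X t w x) y = inner x (regop \<rho> X t w y)" for x y
    by (simp add: regop_def Vop_def outer_def inner_add inner_sum_left inner_sum_right inner_commute mult_ac)
  show "\<rho> * (norm x)\<^sup>2 \<le> inner (regop \<rho> X t w x) x" for x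
    by (simp add: inner_regop sum_nonneg)
qed (rule assms)

text \<open>The inverse square root is defined pointwise by a description, so measurability is read
  off the variational formula, as a supremum over a countable dense set. The measure
  \<open>N\<close> is general because both \<open>F t\<close> and \<open>M\<close> are
  needed.\<close>

lemma borel_measurable_norm_inv_sqrt_regop:
  fixes X :: "nat \<Rightarrow> 'a \<Rightarrow> 'h::{real_inner, complete_space, second_countable_topology}"
  assumes "0 < \<rho>" and X[measurable]: "\<And>i. i \<in> {1..t} \<Longrightarrow> X i \<in> borel_measurable N"
    and [measurable]: "m \<in> borel_measurable N"
  shows "(\<lambda>w. norm (inv_sqrt_op (regop \<rho> X t w) (m w))) \<in> borel_measurable N"
proof -
  obtain E :: "'h set" where E: "countable E" "\<And>U. open U \<Longrightarrow> U \<noteq> {} \<Longrightarrow> \<exists>d\<in>E. d \<in> U"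
    using countable_dense_setE by blast
  let ?f = "\<lambda>x w. 2 * inner (m w) x - (\<rho> * (norm x)\<^sup>2 + (\<Sum>i\<in>{1..t}. (inner (X i w) x)\<^sup>2))"
  have "{w \<in> space N. c < (norm (inv_sqrt_op (regop \<rho> X t w) (m w)))\<^sup>2}
      = (\<Union>x\<in>E. {w \<in> space N. c < ?f x w})" for c
  proof (intro set_eqI iffI)
    fix w assume w: "w \<in> {w \<in> space N. c < (norm (inv_sqrt_op (regop \<rho> X t w) (m w)))\<^sup>2}"
    interpret coercive_operator "regop \<rho> X t w" \<rho> by (rule coercive_regop) fact
    define z where "z = inv_sqrt_op (regop \<rho> X t w) (inv_sqrt_op (regop \<rho> X t w) (m w))"
    have "c < ?f z w" using w norm_inv_sqrt_op_attained[OF z_def] by (simp add: inner_regop)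
    \<comment> \<open>Openness allows the maximiser \<open>z\<close> to be replaced by a point of
      the dense set.\<close>
    moreover have "open {x. c < ?f x w}"
      by (intro open_Collect_less continuous_intros)
    ultimately obtain x where "x \<in> E" "c < ?f x w" using E(2)[of "{x. c < ?f x w}"] by blast
    then show "w \<in> (\<Union>x\<in>E. {w \<in> space N. c < ?f x w})" using w by blast
  next
    fix w assume "w \<in> (\<Union>x\<in>E. {w \<in> space N. c < ?f x w})"
    then obtain x where "w \<in> space N" "c < ?f x w" by blast
    moreover interpret coercive_operator "regop \<rho> X t w" \<rho> by (rule coercive_regop) fact
    have "?f x w \<le> (norm (inv_sqrt_op (regop \<rho> X t w) (m w)))\<^sup>2"
      using norm_inv_sqrt_op_ge[of "m w" x] by (simp add: inner_regop)
    ultimately show "w \<in> {w \<in> space N. c < (norm (inv_sqrt_op (regop \<rho> X t w) (m w)))\<^sup>2}"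
      by simp
  qed
  moreover have "(\<Union>x\<in>E. {w \<in> space N. c < ?f x w}) \<in> sets N" for c
    using E(1) by (intro sets.countable_UN'') measurable
  ultimately have "(\<lambda>w. (norm (inv_sqrt_op (regop \<rho> X t w) (m w)))\<^sup>2) \<in> borel_measurable N"
    by (simp add: borel_measurable_iff_greater)
  then have "(\<lambda>w. sqrt ((norm (inv_sqrt_op (regop \<rho> X t w) (m w)))\<^sup>2)) \<in> borel_measurable N"
    by measurable
  then show ?thesis by simp
qed

text \<open>Polarization reduces this to norms.\<close>

lemma borel_measurable_inner_inv_sqrt_regop:
  fixes X :: "nat \<Rightarrow> 'a \<Rightarrow> 'h::{real_inner, complete_space, second_countable_topology}"
  assumes "0 < \<rho>" and "\<And>i. i \<in> {1..t} \<Longrightarrow> X i \<in> borel_measurable N"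
    and [measurable]: "m \<in> borel_measurable N" "v \<in> borel_measurable N"
  shows "(\<lambda>w. inner (inv_sqrt_op (regop \<rho> X t w) (m w)) (inv_sqrt_op (regop \<rho> X t w) (v w)))
    \<in> borel_measurable N"
proof -
  let ?S = "\<lambda>w. inv_sqrt_op (regop \<rho> X t w)"
  have eq: "inner (?S w (m w)) (?S w (v w))
      = ((norm (?S w (m w + v w)))\<^sup>2 - (norm (?S w (m w - v w)))\<^sup>2) / 4" for w
  proof -
    interpret coercive_operator "regop \<rho> X t w" \<rho> by (rule coercive_regop) fact
    interpret S: bounded_linear "?S w" by (rule inv_sqrt_op_bounded_linear)
    show ?thesis
      by (simp add: S.add S.diff power2_norm_eq_inner inner_add inner_diff inner_commute)
  qed
  have [measurable]: "(\<lambda>w. norm (?S w (m w + v w))) \<in> borel_measurable N"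
    "(\<lambda>w. norm (?S w (m w - v w))) \<in> borel_measurable N"
    by (rule borel_measurable_norm_inv_sqrt_regop[OF assms(1,2)]; measurable)+
  show ?thesis unfolding eq by measurable
qed

section \<open>The exponential supermartingale\<close>

lemma Msum_Suc: "Msum X \<epsilon> (Suc t) w = Msum X \<epsilon> t w + \<epsilon> (Suc t) w *\<^sub>R X (Suc t) w"
  by (simp add: Msum_def)

text \<open>The setting of the theorem for \<open>0 < B\<close>; vanishing \<open>B\<close> is
  treated in the theorem's own proof.\<close>

locale self_normalized_martingale = prob_space M for M :: "'a measure" +
  fixes F :: "nat \<Rightarrow> 'a measure"
    and X :: "nat \<Rightarrow> 'a \<Rightarrow> 'h::{real_inner, complete_space, second_countable_topology}"
    and \<epsilon> \<sigma> :: "nat \<Rightarrow> 'a \<Rightarrow> real"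
    and n :: nat and B \<rho> C :: real
  assumes subalg: "\<And>t. subalgebra M (F t)"
    and filtration: "\<And>s t. s \<le> t \<Longrightarrow> sets (F s) \<subseteq> sets (F t)"
    and X_measurable: "\<And>t. t \<in> {1..n} \<Longrightarrow> X t \<in> borel_measurable (F (t - 1))"
    and eps_measurable: "\<And>t. t \<in> {1..n} \<Longrightarrow> \<epsilon> t \<in> borel_measurable (F t)"
    and eps_centered: "\<And>t. t \<in> {1..n} \<Longrightarrow> AE w in M. real_cond_exp M (F (t - 1)) (\<epsilon> t) w = 0"
    and eps_bounded: "\<And>i. i \<in> {1..n} \<Longrightarrow> AE w in M. \<bar>\<epsilon> i w\<bar> \<le> B"
    and sigma_measurable: "\<And>i. i \<in> {1..n} \<Longrightarrow> \<sigma> i \<in> borel_measurable (F (i - 1))"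
    and cond_var_le: "\<And>i. i \<in> {1..n} \<Longrightarrow> AE w in M.
           real_cond_exp M (F (i - 1))
             (\<lambda>v. (\<epsilon> i v - real_cond_exp M (F (i - 1)) (\<epsilon> i) v)\<^sup>2) w \<le> (\<sigma> i w)\<^sup>2"
    and rho_pos: "0 < \<rho>"
    and quad_var_le: "AE w in M. (\<Sum>i\<in>{1..n}. (\<sigma> i w)\<^sup>2 *
           (norm (inv_sqrt_op (regop \<rho> X i w) (X i w)))\<^sup>2) \<le> C\<^sup>2"
    and B_pos: "0 < B"
begin

abbreviation S :: "nat \<Rightarrow> 'a \<Rightarrow> 'h \<Rightarrow> 'h" where
  "S t w \<equiv> inv_sqrt_op (regop \<rho> X t w)"

definition Z :: "nat \<Rightarrow> 'a \<Rightarrow> real" where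
  "Z t w = norm (S t w (Msum X \<epsilon> t w))"

definition G :: "nat \<Rightarrow> 'a \<Rightarrow> real" where
  "G t w = norm (S t w (X t w))"

definition Q :: "nat \<Rightarrow> 'a \<Rightarrow> real" where
  "Q t w = (\<Sum>i\<in>{1..t}. (\<sigma> i w)\<^sup>2 * (G i w)\<^sup>2)"

text \<open>The operator already contains \<open>X (Suc t)\<close>, the sum stops at
  \<open>t\<close>: everything is known at time \<open>t\<close>.\<close>

definition Zpred :: "nat \<Rightarrow> 'a \<Rightarrow> real" where
  "Zpred t w = norm (S (Suc t) w (Msum X \<epsilon> t w))"

definition \<phi> :: "real \<Rightarrow> real" where
  "\<phi> l = (exp (l * B) - 1 - l * B) / B\<^sup>2"

definition U :: "real \<Rightarrow> nat \<Rightarrow> 'a \<Rightarrow> real" where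
  "U l t w = cosh (l * Z t w) * exp (- \<phi> l * Q t w)"

lemma coercive: "coercive_operator (regop \<rho> X t w) \<rho>"
  by (rule coercive_regop[OF rho_pos])

lemma S_bounded_linear: "bounded_linear (S t w)"
  by (rule coercive_operator.inv_sqrt_op_bounded_linear[OF coercive])

lemma phi_nonneg: "0 \<le> \<phi> l"
  unfolding \<phi>_def using exp_ge_add_one_self[of "l * B"] by (intro divide_nonneg_nonneg) (linarith, simp)

lemma Q_nonneg: "0 \<le> Q t w"
  by (simp add: Q_def sum_nonneg)

lemma G_nonneg: "0 \<le> G t w"
  by (simp add: G_def)

lemma Z_nonneg: "0 \<le> Z t w"
  by (simp add: Z_def)

lemma Zpred_nonneg: "0 \<le> Zpred t w"
  by (simp add: Zpred_def)

lemma Zpred_le: "Zpred t w \<le> Z t w"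
  unfolding Zpred_def Z_def
  by (rule norm_inv_sqrt_op_antimono[OF coercive coercive]) (simp add: inner_regop)

text \<open>The operator at time \<open>Suc t\<close> dominates the rank-one operator of
  \<open>X (Suc t)\<close> itself.\<close>

lemma G_le_1: "G (Suc t) w \<le> 1"
  unfolding G_def
  by (rule coercive_operator.norm_inv_sqrt_op_le_1[OF coercive])
    (use rho_pos in \<open>auto simp: inner_regop intro!: add_nonneg_nonneg sum_nonneg\<close>)

lemma S_Msum_Suc:
  "S (Suc t) w (Msum X \<epsilon> (Suc t) w)
    = S (Suc t) w (Msum X \<epsilon> t w) + \<epsilon> (Suc t) w *\<^sub>R S (Suc t) w (X (Suc t) w)"
proof -
  interpret S: bounded_linear "S (Suc t) w" by (rule S_bounded_linear)
  show ?thesis by (simp add: Msum_Suc S.add S.scaleR)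
qed

lemma Z_0: "Z 0 w = 0"
  using linear_0[OF bounded_linear.linear[OF S_bounded_linear]] by (simp add: Z_def Msum_def)

lemma AE_eps_bounded: "AE w in M. \<forall>i\<in>{1..n}. \<bar>\<epsilon> i w\<bar> \<le> B"
  by (rule AE_finite_allI) (auto intro: eps_bounded)

text \<open>A crude deterministic bound, used only for integrability.\<close>

lemma Z_le:
  assumes "\<forall>i\<in>{1..n}. \<bar>\<epsilon> i w\<bar> \<le> B" "t \<le> n"
  shows "Z t w \<le> real n * B"
proof -
  have "Z t w \<le> real t * B" using assms(2)
  proof (induction t)
    case (Suc t)
    have "Z (Suc t) w \<le> Zpred t w + \<bar>\<epsilon> (Suc t) w\<bar> * G (Suc t) w"
      unfolding Z_def Zpred_def G_def S_Msum_Suc by (rule order_trans[OF norm_triangle_ineq]) simp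
    also have "\<dots> \<le> real t * B + B * 1"
      using Suc assms Zpred_le[of t w] B_pos
      by (intro add_mono mult_mono G_le_1 G_nonneg) auto
    finally show ?case by (simp add: algebra_simps)
  qed (simp add: Z_0)
  also have "\<dots> \<le> real n * B" using assms B_pos by (intro mult_right_mono) auto
  finally show ?thesis .
qed

lemma measurable_F_mono: "f \<in> borel_measurable (F s) \<Longrightarrow> s \<le> t \<Longrightarrow> f \<in> borel_measurable (F t)"
  using filtration[of s t] subalg[of s] subalg[of t]
  by (intro measurable_from_subalg[of "F t" "F s"]) (auto simp: subalgebra_def)

lemma measurable_F_M: "f \<in> borel_measurable (F s) \<Longrightarrow> f \<in> borel_measurable M"
  by (rule measurable_from_subalg[OF subalg])

lemma X_measurable': "i \<in> {1..Suc t} \<Longrightarrow> Suc t \<le> n \<Longrightarrow> X i \<in> borel_measurable (F t)"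
  by (rule measurable_F_mono[OF X_measurable]) auto

lemma Msum_measurable: "t \<le> n \<Longrightarrow> Msum X \<epsilon> t \<in> borel_measurable (F t)"
  unfolding Msum_def[abs_def]
  by (intro borel_measurable_sum borel_measurable_scaleR
      measurable_F_mono[OF X_measurable] measurable_F_mono[OF eps_measurable]) auto

lemma Z_measurable: "t \<le> n \<Longrightarrow> Z t \<in> borel_measurable (F t)"
  unfolding Z_def[abs_def]
  by (intro borel_measurable_norm_inv_sqrt_regop rho_pos Msum_measurable
      measurable_F_mono[OF X_measurable]) auto

lemma Zpred_measurable: "Suc t \<le> n \<Longrightarrow> Zpred t \<in> borel_measurable (F t)"
  unfolding Zpred_def[abs_def]
  by (intro borel_measurable_norm_inv_sqrt_regop rho_pos Msum_measurable X_measurable') auto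

lemma G_measurable: "i \<in> {1..Suc t} \<Longrightarrow> Suc t \<le> n \<Longrightarrow> G i \<in> borel_measurable (F t)"
  unfolding G_def[abs_def]
  by (intro borel_measurable_norm_inv_sqrt_regop rho_pos X_measurable') auto

lemma Q_measurable: "Suc t \<le> n \<Longrightarrow> Q (Suc t) \<in> borel_measurable (F t)"
  unfolding Q_def[abs_def]
  by (intro borel_measurable_sum borel_measurable_times borel_measurable_power G_measurable
      measurable_F_mono[OF sigma_measurable]) auto

lemma Q_measurable':
  assumes "t \<le> n"
  shows "Q t \<in> borel_measurable (F t)"
proof (cases t)
  case 0
  then show ?thesis by (simp add: Q_def[abs_def])
next
  case (Suc s)
  then show ?thesis
    using assms measurable_F_mono[OF Q_measurable, of s t] by simp
qed

lemma U_measurable: "t \<le> n \<Longrightarrow> U l t \<in> borel_measurable (F t)"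
  using Z_measurable[of t] Q_measurable'[of t] unfolding U_def[abs_def]
  by (auto simp: cosh_def)

lemma U_nonneg: "0 \<le> U l t w"
  by (simp add: U_def)

lemma integrable_indicator_U:
  assumes "0 < l" "t \<le> n" "A \<in> sets M"
  shows "integrable M (\<lambda>w. indicator A w * U l t w)"
proof (rule integrable_const_bound)
  show "AE w in M. norm (indicator A w * U l t w) \<le> cosh (l * (real n * B))"
    using AE_eps_bounded
  proof eventually_elim
    case (elim w)
    have "U l t w \<le> cosh (l * (real n * B)) * 1"
      unfolding U_def using Z_le[OF elim assms(2)] Z_nonneg[of t w] assms(1) phi_nonneg[of l] Q_nonneg[of t w]
      by (intro mult_mono cosh_mono_nonneg mult_left_mono) auto
    then show ?case using U_nonneg[of l t w] by (auto simp: indicator_def)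
  qed
  show "(\<lambda>w. indicator A w * U l t w) \<in> borel_measurable M"
    using assms measurable_F_M[OF U_measurable[of t l]] by measurable
qed

text \<open>The bound is affine in \<open>\<epsilon>\<close> and \<open>\<epsilon>\<^sup>2\<close> with coefficients known at time \<open>t\<close>, so that only the
  conditional mean and variance are needed afterwards.\<close>
lemma cosh_Z_Suc_le:
  assumes "0 < l" "\<bar>\<epsilon> (Suc t) w\<bar> \<le> B"
  shows "cosh (l * Z (Suc t) w) \<le> cosh (l * Zpred t w)
    + l * sinh (l * Zpred t w) / Zpred t w
        * inner (S (Suc t) w (Msum X \<epsilon> t w)) (S (Suc t) w (X (Suc t) w)) * \<epsilon> (Suc t) w
    + cosh (l * Zpred t w) * ((G (Suc t) w)\<^sup>2 * \<phi> l) * (\<epsilon> (Suc t) w)\<^sup>2"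
proof -
  define a g e where "a = S (Suc t) w (Msum X \<epsilon> t w)" and "g = S (Suc t) w (X (Suc t) w)"
    and "e = \<epsilon> (Suc t) w"
  have "norm (l *\<^sub>R a + (l * e) *\<^sub>R g) = l * norm (a + e *\<^sub>R g)"
    using assms(1) norm_scaleR[of l "a + e *\<^sub>R g"] by (simp add: scaleR_add_right)
  then have "cosh (l * norm (a + e *\<^sub>R g)) \<le> cosh (l * norm a)
      + sinh (l * norm a) / (l * norm a) * inner (l *\<^sub>R a) ((l * e) *\<^sub>R g)
      + cosh (l * norm a) * (exp (norm ((l * e) *\<^sub>R g)) - 1 - norm ((l * e) *\<^sub>R g))"
    using cosh_norm_add_le[of "l *\<^sub>R a" "(l * e) *\<^sub>R g"] assms(1) by simp
  also have "sinh (l * norm a) / (l * norm a) * inner (l *\<^sub>R a) ((l * e) *\<^sub>R g)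
      = l * sinh (l * norm a) / norm a * inner a g * e"
    using assms(1) by (simp add: field_simps)
  \<comment> \<open>As \<open>norm g\<close> is at most 1, the norm of the increment is at most
    \<open>l * B\<close>, and the remainder becomes quadratic in \<open>e\<close> with constant
    \<open>\<phi> l\<close>.\<close>
  also have "exp (norm ((l * e) *\<^sub>R g)) - 1 - norm ((l * e) *\<^sub>R g) \<le> (norm g)\<^sup>2 * \<phi> l * e\<^sup>2"
  proof -
    have ng: "norm ((l * e) *\<^sub>R g) = l * (\<bar>e\<bar> * norm g)" using assms(1) by (simp add: abs_mult)
    have "\<bar>e\<bar> * norm g \<le> B * 1"
      using assms(2) G_le_1[of t w] B_pos by (intro mult_mono) (auto simp: e_def g_def G_def)
    then have "l * (\<bar>e\<bar> * norm g) \<le> l * B" using assms(1) by simp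
    then have "exp (norm ((l * e) *\<^sub>R g)) - 1 - norm ((l * e) *\<^sub>R g)
        \<le> (l * (\<bar>e\<bar> * norm g))\<^sup>2 * ((exp (l * B) - 1 - l * B) / (l * B)\<^sup>2)"
      unfolding ng using assms(1) B_pos by (intro exp_remainder_quadratic_le) auto
    also have "\<dots> = (norm g)\<^sup>2 * \<phi> l * e\<^sup>2"
      using assms(1) by (simp add: \<phi>_def power_mult_distrib)
    finally show ?thesis .
  qed
  finally show ?thesis
    unfolding Z_def S_Msum_Suc Zpred_def G_def
    by (simp add: a_def g_def e_def mult_left_mono mult.assoc)
qed

text \<open>The supermartingale property integrated over events of \<open>F t\<close>, the form in
  which the stopping argument uses it. The cosh bound splits into terms with
  \<open>F t\<close>-measurable coefficients; the linear one integrates to 0, and the quadratic one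
  is paid for by the increment of \<open>Q\<close>.\<close>

lemma supermartingale_step:
  assumes l: "0 < l" and t: "Suc t \<le> n" and A: "A \<in> sets (F t)"
  shows "(\<integral>w. indicator A w * U l (Suc t) w \<partial>M) \<le> (\<integral>w. indicator A w * U l t w \<partial>M)"
proof -
  interpret Ft: finite_measure_subalgebra M "F t"
    by unfold_locales (rule subalg)
  have AM: "A \<in> sets M" using A subalg[of t] by (auto simp: subalgebra_def)
  let ?e = "\<epsilon> (Suc t)"
  have e_meas: "?e \<in> borel_measurable M"
    using eps_measurable[of "Suc t"] t by (intro measurable_F_M[of _ "Suc t"]) auto
  define k where "k w = inner (S (Suc t) w (Msum X \<epsilon> t w)) (S (Suc t) w (X (Suc t) w))" for w
  \<comment> \<open>The whole weight, including \<open>Q (Suc t)\<close>, is known at time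
    \<open>t\<close> and joins the coefficients.\<close>
  define f where "f w = indicator A w * exp (- \<phi> l * Q (Suc t) w)" for w
  define c0 where "c0 w = f w * cosh (l * Zpred t w)" for w
  define c1 where "c1 w = f w * (l * sinh (l * Zpred t w) / Zpred t w * k w)" for w
  define c2 where "c2 w = f w * (cosh (l * Zpred t w) * ((G (Suc t) w)\<^sup>2 * \<phi> l))" for w
  have k_meas: "k \<in> borel_measurable (F t)"
    unfolding k_def[abs_def] using t
    by (intro borel_measurable_inner_inv_sqrt_regop rho_pos Msum_measurable X_measurable') auto
  note [measurable] = k_meas A Q_measurable[OF t] Zpred_measurable[OF t] G_measurable[OF _ t, of "Suc t"]
  have [measurable]: "G (Suc t) \<in> borel_measurable (F t)" by (rule G_measurable[OF _ t]) simp
  have [measurable]: "f \<in> borel_measurable (F t)" unfolding f_def[abs_def] by measurable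
  have c_meas: "c0 \<in> borel_measurable (F t)" "c1 \<in> borel_measurable (F t)" "c2 \<in> borel_measurable (F t)"
    unfolding c0_def[abs_def] c1_def[abs_def] c2_def[abs_def] cosh_def sinh_def by measurable
  note cM = c_meas[THEN measurable_F_M]
  have f: "0 \<le> f w" "f w \<le> 1" for w
    using phi_nonneg[of l] Q_nonneg[of "Suc t" w] by (auto simp: f_def indicator_def)
  define K where "K = l * (real n * B)"
  have bounds: "AE w in M. \<bar>?e w\<bar> \<le> B \<and> \<bar>c0 w\<bar> \<le> cosh K \<and> \<bar>c1 w\<bar> \<le> l * sinh K \<and> \<bar>c2 w\<bar> \<le> cosh K * \<phi> l"
    using AE_eps_bounded
  proof eventually_elim
    case (elim w)
    have a: "0 \<le> l * Zpred t w" "l * Zpred t w \<le> K"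
      using Z_le[OF elim, of t] Zpred_le[of t w] Zpred_nonneg[of t w] l t by (auto simp: K_def)
    then have ch: "cosh (l * Zpred t w) \<le> cosh K" and sh: "sinh (l * Zpred t w) \<le> sinh K"
      by (auto intro: cosh_mono_nonneg)
    have g: "0 \<le> G (Suc t) w" "G (Suc t) w \<le> 1" by (rule G_nonneg G_le_1)+
    have fb: "\<bar>f w * x\<bar> \<le> y" if "\<bar>x\<bar> \<le> y" for x y
      using mult_mono[OF f(2)[of w] that] f(1)[of w] by (simp add: abs_mult)
    \<comment> \<open>Cauchy-Schwarz cancels the denominator; at \<open>Zpred t w = 0\<close> the
      quotient is 0 by convention.\<close>
    have "\<bar>k w / Zpred t w\<bar> \<le> 1"
    proof (cases "Zpred t w = 0")
      case False
      have "\<bar>k w\<bar> \<le> Zpred t w * G (Suc t) w"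
        unfolding k_def Zpred_def G_def by (rule Cauchy_Schwarz_ineq2)
      also have "\<dots> \<le> Zpred t w * 1" using g Zpred_nonneg by (intro mult_left_mono)
      finally show ?thesis using False Zpred_nonneg[of t w] by (simp add: abs_div)
    qed simp
    then have "\<bar>l * sinh (l * Zpred t w) * (k w / Zpred t w)\<bar> \<le> l * sinh K * 1"
      unfolding abs_mult using l sh a by (intro mult_mono) auto
    moreover have "\<bar>cosh (l * Zpred t w) * ((G (Suc t) w)\<^sup>2 * \<phi> l)\<bar> \<le> cosh K * (1 * \<phi> l)"
      unfolding abs_mult using ch g phi_nonneg[of l]
      by (intro mult_mono) (auto simp: abs_square_le_1 power_le_one)
    ultimately show ?case
      using elim t ch unfolding c0_def c1_def c2_def by (intro conjI fb) auto
  qed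
  have int0: "integrable M c0"
    by (rule integrable_const_bound[of _ "cosh K", OF _ cM(1)])
      (use bounds in \<open>auto elim!: eventually_mono simp del: AE_conj_iff\<close>)
  have int1: "integrable M (\<lambda>w. c1 w * ?e w)"
  proof (rule integrable_const_bound)
    show "AE w in M. norm (c1 w * ?e w) \<le> l * sinh K * B"
      using bounds by eventually_elim (use B_pos in \<open>auto simp: abs_mult intro!: mult_mono'\<close>)
  qed (use cM e_meas in measurable)
  have int2: "integrable M (\<lambda>w. c2 w * (?e w)\<^sup>2)"
  proof (rule integrable_const_bound)
    show "AE w in M. norm (c2 w * (?e w)\<^sup>2) \<le> cosh K * \<phi> l * B\<^sup>2"
      using bounds by eventually_elim
        (use B_pos in \<open>auto simp: abs_mult abs_le_square_iff[symmetric] intro!: mult_mono'\<close>)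
  qed (use cM e_meas in measurable)
  \<comment> \<open>The variance hypothesis concerns the centred square, which equals
    \<open>(?e w)^2\<close> almost surely because the conditional mean is 0.\<close>
  define \<eta> where "\<eta> w = (?e w - real_cond_exp M (F t) ?e w)\<^sup>2" for w
  have \<eta>_meas: "\<eta> \<in> borel_measurable M" unfolding \<eta>_def[abs_def] using e_meas by measurable
  have centered: "AE w in M. real_cond_exp M (F t) ?e w = 0"
    using eps_centered[of "Suc t"] t by simp
  then have \<eta>: "AE w in M. c2 w * (?e w)\<^sup>2 = c2 w * \<eta> w"
    by eventually_elim (simp add: \<eta>_def)
  have int\<eta>: "integrable M (\<lambda>w. c2 w * \<eta> w)"
    by (rule integrable_cong_AE_imp[OF int2]) (use cM \<eta>_meas \<eta> in \<open>auto elim: eventually_mono\<close>)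
  note ce2 = Ft.real_cond_exp_intg[OF int\<eta> c_meas(3) \<eta>_meas]
  have zero: "(\<integral>w. c1 w * ?e w \<partial>M) = 0"
  proof -
    have "(\<integral>w. c1 w * ?e w \<partial>M) = (\<integral>w. c1 w * real_cond_exp M (F t) ?e w \<partial>M)"
      using Ft.real_cond_exp_intg(2)[OF int1 c_meas(2) e_meas] by simp
    also have "\<dots> = 0"
      by (rule integral_eq_zero_AE) (use centered in \<open>auto elim: eventually_mono\<close>)
    finally show ?thesis .
  qed
  have "(\<integral>w. indicator A w * U l (Suc t) w \<partial>M)
      \<le> (\<integral>w. c0 w + c1 w * ?e w + c2 w * (?e w)\<^sup>2 \<partial>M)"
  proof (rule integral_mono_AE)
    show "AE w in M. indicator A w * U l (Suc t) w \<le> c0 w + c1 w * ?e w + c2 w * (?e w)\<^sup>2"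
      using bounds
    proof eventually_elim
      case (elim w)
      have "indicator A w * U l (Suc t) w = f w * cosh (l * Z (Suc t) w)"
        by (simp add: f_def U_def)
      also have "\<dots> \<le> c0 w + c1 w * ?e w + c2 w * (?e w)\<^sup>2"
        using mult_left_mono[OF cosh_Z_Suc_le[OF l] f(1)] elim
        by (simp add: c0_def c1_def c2_def k_def distrib_left mult.assoc)
      finally show ?case .
    qed
  qed (use integrable_indicator_U[OF l t AM] int0 int1 int2 in auto)
  also have "\<dots> = (\<integral>w. c0 w \<partial>M) + (\<integral>w. c2 w * (?e w)\<^sup>2 \<partial>M)"
    using int0 int1 int2 zero by simp
  also have "(\<integral>w. c2 w * (?e w)\<^sup>2 \<partial>M) = (\<integral>w. c2 w * \<eta> w \<partial>M)"
    using \<eta> cM e_meas \<eta>_meas by (intro integral_cong_AE) auto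
  also have "\<dots> = (\<integral>w. c2 w * real_cond_exp M (F t) \<eta> w \<partial>M)"
    using ce2(2) by simp
  also have "(\<integral>w. c0 w \<partial>M) + \<dots> = (\<integral>w. c0 w + c2 w * real_cond_exp M (F t) \<eta> w \<partial>M)"
    using int0 ce2(1) by simp
  also have "\<dots> \<le> (\<integral>w. indicator A w * U l t w \<partial>M)"
  proof (rule integral_mono_AE)
    have "AE w in M. real_cond_exp M (F t) \<eta> w \<le> (\<sigma> (Suc t) w)\<^sup>2"
      using cond_var_le[of "Suc t"] t by (simp add: \<eta>_def[abs_def])
    then show "AE w in M. c0 w + c2 w * real_cond_exp M (F t) \<eta> w \<le> indicator A w * U l t w"
    proof eventually_elim
      case (elim w)
      \<comment> \<open>\<open>d\<close> is \<open>\<phi> l\<close> times the increment of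
        \<open>Q\<close>, so \<open>1 + d \<le> exp d\<close> turns the weight at
        \<open>Suc t\<close> into that at \<open>t\<close>.\<close>
      define d where "d = \<phi> l * ((\<sigma> (Suc t) w)\<^sup>2 * (G (Suc t) w)\<^sup>2)"
      have "c2 w * real_cond_exp M (F t) \<eta> w \<le> c2 w * (\<sigma> (Suc t) w)\<^sup>2"
        using elim f(1)[of w] phi_nonneg[of l] by (intro mult_left_mono) (auto simp: c2_def)
      then have "c0 w + c2 w * real_cond_exp M (F t) \<eta> w \<le> c0 w * (1 + d)"
        by (simp add: c0_def c2_def d_def algebra_simps)
      also have "\<dots> \<le> c0 w * exp d"
        using f(1)[of w] exp_ge_add_one_self[of d] by (intro mult_left_mono) (auto simp: c0_def)
      also have "\<dots> = indicator A w * (exp (- \<phi> l * Q t w) * cosh (l * Zpred t w))"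
      proof -
        have "- \<phi> l * Q (Suc t) w + d = - \<phi> l * Q t w" by (simp add: Q_def d_def algebra_simps)
        then show ?thesis by (simp add: c0_def f_def mult_ac flip: exp_add)
      qed
      also have "\<dots> \<le> indicator A w * (exp (- \<phi> l * Q t w) * cosh (l * Z t w))"
        using l Zpred_nonneg[of t w] Zpred_le[of t w]
        by (intro mult_left_mono cosh_mono_nonneg) auto
      finally show ?case by (simp add: U_def mult_ac)
    qed
  qed (use integrable_indicator_U[OF l _ AM, of t] t int0 ce2 in auto)
  finally show ?thesis .
qed

section \<open>The maximal inequality\<close>

definition H :: "real \<Rightarrow> real \<Rightarrow> nat \<Rightarrow> 'a set" where
  "H l c t = {w \<in> space M. \<exists>s\<in>{..t}. c \<le> U l s w}"

lemma H_sets: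
  assumes t: "t \<le> n"
  shows "H l c t \<in> sets (F t)"
proof -
  have sp: "space (F t) = space M" using subalg[of t] by (simp add: subalgebra_def)
  have "U l s \<in> borel_measurable (F t)" if "s \<in> {..t}" for s
    using that t by (intro measurable_F_mono[OF U_measurable]) auto
  then have "{w \<in> space (F t). c \<le> U l s w} \<in> sets (F t)" if "s \<in> {..t}" for s
    using that by measurable
  then have "(\<Union>s\<in>{..t}. {w \<in> space (F t). c \<le> U l s w}) \<in> sets (F t)" by blast
  also have "(\<Union>s\<in>{..t}. {w \<in> space (F t). c \<le> U l s w}) = H l c t"
    by (auto simp: H_def sp)
  finally show ?thesis .
qed

lemma H_sets_M: "t \<le> n \<Longrightarrow> H l c t \<in> sets M"
  using H_sets[of t l c] subalg[of t] by (auto simp: subalgebra_def)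

lemma integrable_const_indicator: "A \<in> sets M \<Longrightarrow> integrable M (\<lambda>w. c * indicator A w)" for c :: real
  by (intro integrable_mult_right integrable_real_indicator) (auto simp: emeasure_eq_measure)

text \<open>The integrand is the supermartingale stopped, with value \<open>c\<close>, on first reaching \<open>c\<close>.\<close>
lemma stopped_integral_le:
  assumes l: "0 < l" and t: "t \<le> n"
  shows "(\<integral>w. c * indicator (H l c t) w + indicator (space M - H l c t) w * U l t w \<partial>M) \<le> 1"
  using t
proof (induction t)
  case 0
  \<comment> \<open>At time 0 the process is constantly 1, and stopping replaces it by
    \<open>c\<close> only if \<open>c\<close> is at most 1.\<close>
  have "(\<integral>w. c * indicator (H l c 0) w + indicator (space M - H l c 0) w * U l 0 w \<partial>M) \<le> (\<integral>w. 1 \<partial>M)"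
  proof (rule integral_mono)
    show "integrable M (\<lambda>w. c * indicator (H l c 0) w + indicator (space M - H l c 0) w * U l 0 w)"
      using H_sets_M[of 0 l c] 
      by (intro Bochner_Integration.integrable_add integrable_const_indicator integrable_indicator_U[OF l]) auto
  qed (auto simp: H_def U_def Z_0 Q_def indicator_def)
  then show ?case by (simp add: prob_space)
next
  case (Suc t)
  let ?H = "H l c t" and ?H' = "H l c (Suc t)"
  have sets: "?H \<in> sets M" "?H' \<in> sets M" "space M - ?H \<in> sets (F t)"
    using Suc.prems H_sets_M[of t l c] H_sets_M[of "Suc t" l c] sets.compl_sets[OF H_sets[of t l c]] subalg[of t]
    by (auto simp: subalgebra_def)
  have intU: "integrable M (\<lambda>w. indicator (space M - A) w * U l s w)" if "A \<in> sets M" "s \<le> n" for A s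
    using that by (intro integrable_indicator_U[OF l]) auto
  \<comment> \<open>Where level \<open>c\<close> is first reached at time \<open>Suc t\<close>, the
    process is at least \<open>c\<close>, so freezing it at \<open>c\<close> can only lower the
    integral.\<close>
  have "(\<integral>w. c * indicator ?H' w + indicator (space M - ?H') w * U l (Suc t) w \<partial>M)
      \<le> (\<integral>w. c * indicator ?H w + indicator (space M - ?H) w * U l (Suc t) w \<partial>M)"
  proof (rule integral_mono)
    fix w assume "w \<in> space M"
    then show "c * indicator ?H' w + indicator (space M - ?H') w * U l (Suc t) w
        \<le> c * indicator ?H w + indicator (space M - ?H) w * U l (Suc t) w"
      by (auto simp: H_def indicator_def atMost_Suc)
  qed (use Suc.prems sets in \<open>auto intro!: Bochner_Integration.integrable_add integrable_const_indicator intU\<close>)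
  also have "\<dots> = (\<integral>w. c * indicator ?H w \<partial>M) + (\<integral>w. indicator (space M - ?H) w * U l (Suc t) w \<partial>M)"
    using Suc.prems sets by (intro Bochner_Integration.integral_add integrable_const_indicator intU)
  also have "\<dots> \<le> (\<integral>w. c * indicator ?H w \<partial>M) + (\<integral>w. indicator (space M - ?H) w * U l t w \<partial>M)"
    by (intro add_left_mono supermartingale_step[OF l Suc.prems sets(3)])
  also have "\<dots> = (\<integral>w. c * indicator ?H w + indicator (space M - ?H) w * U l t w \<partial>M)"
    using Suc.prems sets by (intro Bochner_Integration.integral_add[symmetric] integrable_const_indicator intU) auto
  also have "\<dots> \<le> 1" using Suc by simp
  finally show ?case .
qed

text \<open>Drop the nonnegative part of the stopped process that has not reached
  \<open>c\<close>.\<close>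

lemma maximal_inequality:
  assumes l: "0 < l"
  shows "c * prob (H l c n) \<le> 1"
proof -
  have "c * prob (H l c n) = (\<integral>w. c * indicator (H l c n) w \<partial>M)"
    using H_sets_M[of n l c] by simp
  also have "\<dots> \<le> (\<integral>w. c * indicator (H l c n) w + indicator (space M - H l c n) w * U l n w \<partial>M)"
    using H_sets_M[of n l c]
    by (intro integral_mono Bochner_Integration.integrable_add integrable_const_indicator
        integrable_indicator_U[OF l])
      (auto simp: U_nonneg)
  also have "\<dots> \<le> 1" by (rule stopped_integral_le[OF l order_refl])
  finally show ?thesis .
qed

section \<open>Tail bound and its inversion\<close>

lemma Z_exceeds_sets: "{w \<in> space M. \<exists>t\<in>{1..n}. r < Z t w} \<in> sets M"
proof -
  have "{w \<in> space M. r < Z t w} \<in> sets M" if "t \<in> {1..n}" for t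
  proof -
    have [measurable]: "Z t \<in> borel_measurable M"
      using that by (intro measurable_F_M[OF Z_measurable]) simp
    show ?thesis by measurable
  qed
  then have "(\<Union>t\<in>{1..n}. {w \<in> space M. r < Z t w}) \<in> sets M" by blast
  also have "(\<Union>t\<in>{1..n}. {w \<in> space M. r < Z t w}) = {w \<in> space M. \<exists>t\<in>{1..n}. r < Z t w}"
    by auto
  finally show ?thesis .
qed

text \<open>Since \<open>Q\<close> stays below \<open>C^2\<close> almost surely, \<open>Z\<close>
  exceeding \<open>r\<close> forces \<open>U\<close> to reach the deterministic level
  \<open>c\<close>.\<close>

lemma tail_bound:
  assumes l: "0 < l" and r: "0 \<le> r"
  shows "prob {w \<in> space M. \<exists>t\<in>{1..n}. r < Z t w} \<le> 2 * exp (\<phi> l * C\<^sup>2 - l * r)"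
proof -
  define c where "c = cosh (l * r) * exp (- \<phi> l * C\<^sup>2)"
  have c: "0 < c" by (simp add: c_def)
  have "AE w in M. w \<in> {w \<in> space M. \<exists>t\<in>{1..n}. r < Z t w} \<longrightarrow> w \<in> H l c n"
    using quad_var_le
  proof (eventually_elim, clarify)
    fix w t
    assume q: "(\<Sum>i\<in>{1..n}. (\<sigma> i w)\<^sup>2 * (norm (S i w (X i w)))\<^sup>2) \<le> C\<^sup>2"
      and w: "w \<in> space M" and t: "t \<in> {1..n}" "r < Z t w"
    have "Q t w \<le> Q n w" unfolding Q_def using t by (intro sum_mono2) auto
    then have "Q t w \<le> C\<^sup>2" using q by (simp add: Q_def G_def)
    then have "\<phi> l * Q t w \<le> \<phi> l * C\<^sup>2" by (intro mult_left_mono phi_nonneg)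
    then have "c \<le> U l t w"
      unfolding c_def U_def using l r t by (intro mult_mono cosh_mono_nonneg) auto
    then show "w \<in> H l c n" using w t by (auto simp: H_def)
  qed
  then have "prob {w \<in> space M. \<exists>t\<in>{1..n}. r < Z t w} \<le> prob (H l c n)"
    by (rule finite_measure_mono_AE) (rule H_sets_M, simp)
  also have "\<dots> \<le> 1 / c"
    using maximal_inequality[OF l, of c] c by (simp add: field_simps)
  \<comment> \<open>The factor 2 arises here, from \<open>cosh x\<close> being at least
    \<open>exp x / 2\<close>.\<close>
  also have "\<dots> \<le> 1 / (exp (l * r) / 2 * exp (- \<phi> l * C\<^sup>2))"
    unfolding c_def
    by (intro divide_left_mono mult_right_mono mult_pos_pos) (auto simp: cosh_def add_pos_pos)
  also have "\<dots> = 2 * exp (\<phi> l * C\<^sup>2 - l * r)"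
    by (simp add: exp_diff exp_minus field_simps)
  finally show ?thesis .
qed

text \<open>With \<open>C = 0\<close> the bound is \<open>2 * exp (- l * r)\<close>, which vanishes
  as \<open>l\<close> grows only for \<open>r > 0\<close>; the threshold 0 is reached by a countable
  union over \<open>r = 1 / (k + 1)\<close>.\<close>

lemma prob_Z_exceeds_eq_0:
  assumes "C = 0"
  shows "prob {w \<in> space M. \<exists>t\<in>{1..n}. 0 < Z t w} = 0"
proof -
  have null: "prob {w \<in> space M. \<exists>t\<in>{1..n}. r < Z t w} = 0" if r: "0 < r" for r
  proof (rule antisym)
    have "((\<lambda>l. 2 * exp (- (l * r))) \<longlongrightarrow> 0) at_top"
      using r by real_asymp
    then show "prob {w \<in> space M. \<exists>t\<in>{1..n}. r < Z t w} \<le> 0"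
    proof (rule tendsto_lowerbound)
      show "\<forall>\<^sub>F l in at_top. prob {w \<in> space M. \<exists>t\<in>{1..n}. r < Z t w} \<le> 2 * exp (- (l * r))"
        using eventually_gt_at_top[of 0]
        by eventually_elim (use tail_bound[of _ r] r assms in simp)
    qed simp
  qed simp
  have "{w \<in> space M. \<exists>t\<in>{1..n}. 0 < Z t w}
      = (\<Union>k::nat. {w \<in> space M. \<exists>t\<in>{1..n}. 1 / real (Suc k) < Z t w})"
  proof (intro set_eqI iffI)
    fix w assume "w \<in> {w \<in> space M. \<exists>t\<in>{1..n}. 0 < Z t w}"
    then obtain t where t: "w \<in> space M" "t \<in> {1..n}" "0 < Z t w" by auto
    from nat_approx_posE[OF t(3)] obtain k where "1 / real (Suc k) < Z t w" by blast
    with t show "w \<in> (\<Union>k::nat. {w \<in> space M. \<exists>t\<in>{1..n}. 1 / real (Suc k) < Z t w})"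
      by blast
  next
    fix w assume "w \<in> (\<Union>k::nat. {w \<in> space M. \<exists>t\<in>{1..n}. 1 / real (Suc k) < Z t w})"
    then obtain k t where w: "w \<in> space M" "t \<in> {1..n}" "1 / real (Suc k) < Z t w" by auto
    moreover have "0 < 1 / real (Suc k)" by simp
    ultimately have "0 < Z t w" by linarith
    with w show "w \<in> {w \<in> space M. \<exists>t\<in>{1..n}. 0 < Z t w}" by auto
  qed
  also have "prob \<dots> = 0"
  proof -
    have "(\<Union>k::nat. {w \<in> space M. \<exists>t\<in>{1..n}. 1 / real (Suc k) < Z t w}) \<in> null_sets M"
    proof (rule null_sets_UN)
      show "{w \<in> space M. \<exists>t\<in>{1..n}. 1 / real (Suc k) < Z t w} \<in> null_sets M" for k
        using Z_exceeds_sets[of "1 / real (Suc k)"] null[of "1 / real (Suc k)"]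
        by (intro null_setsI) (simp_all only: emeasure_eq_measure, simp)
    qed
    then show ?thesis by (simp add: null_sets_def emeasure_eq_measure)
  qed
  finally show ?thesis .
qed

lemma prob_Z_exceeds_le:
  assumes "0 \<le> C" "0 < \<delta>" "\<delta> < 1"
  shows "prob {w \<in> space M. \<exists>t\<in>{1..n}. C\<^sup>2 / B * hfun_inv (B\<^sup>2 / C\<^sup>2 * ln (2 / \<delta>)) < Z t w} \<le> \<delta>"
proof (cases "C = 0")
  case True
  \<comment> \<open>The threshold is 0 because of its factor \<open>C^2\<close>.\<close>
  then show ?thesis using prob_Z_exceeds_eq_0 assms by simp
next
  case False
  define y where "y = B\<^sup>2 / C\<^sup>2 * ln (2 / \<delta>)"
  define u where "u = hfun_inv y"
  \<comment> \<open>The minimiser of \<open>\<phi> l * C^2 - l * r\<close> at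
    \<open>r = C^2 / B * u\<close>: the derivative vanishes when
    \<open>exp (l * B) = 1 + u\<close>.\<close>
  define l where "l = ln (1 + u) / B"
  have y: "0 < y" using False B_pos assms by (simp add: y_def)
  have u: "0 \<le> u" "hfun u = y" using hfun_inv[of y] y by (auto simp: u_def)
  have "u \<noteq> 0" using u y by (auto simp: hfun_def)
  with u(1) have u0: "0 < u" by simp
  then have l: "0 < l" using B_pos by (simp add: l_def)
  \<comment> \<open>The optimal exponent is the Legendre transform of \<open>\<phi> l * C^2\<close>,
    and \<open>u\<close> was chosen to make it \<open>ln (2 / \<delta>)\<close>.\<close>
  have "l * (C\<^sup>2 / B * u) - \<phi> l * C\<^sup>2 = C\<^sup>2 / B\<^sup>2 * hfun u"
    using u0 B_pos by (simp add: \<phi>_def l_def hfun_def field_simps power2_eq_square)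
  also have "\<dots> = ln (2 / \<delta>)" using False B_pos by (simp add: u y_def)
  finally have "\<phi> l * C\<^sup>2 - l * (C\<^sup>2 / B * u) = - ln (2 / \<delta>)" by simp
  then have "2 * exp (\<phi> l * C\<^sup>2 - l * (C\<^sup>2 / B * u)) = \<delta>"
    using assms by (simp add: exp_minus)
  then show ?thesis
    using tail_bound[OF l, of "C\<^sup>2 / B * u"] u0 B_pos by (simp add: u_def y_def)
qed

lemma concentration:
  assumes "0 < n" "0 \<le> C" "0 < \<delta>" "\<delta> < 1"
  shows "1 - \<delta> \<le> prob {w \<in> space M.
           Max ((\<lambda>t. norm (inv_sqrt_op (regop \<rho> X t w) (Msum X \<epsilon> t w))) ` {1..n})
             \<le> C\<^sup>2 / B * hfun_inv (B\<^sup>2 / C\<^sup>2 * ln (2 / \<delta>))}"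
proof -
  define r where "r = C\<^sup>2 / B * hfun_inv (B\<^sup>2 / C\<^sup>2 * ln (2 / \<delta>))"
  have "{w \<in> space M. Max ((\<lambda>t. norm (inv_sqrt_op (regop \<rho> X t w) (Msum X \<epsilon> t w))) ` {1..n}) \<le> r}
      = space M - {w \<in> space M. \<exists>t\<in>{1..n}. r < Z t w}"
    using assms(1) by (auto simp: Z_def not_less)
  then show ?thesis
    using prob_Z_exceeds_le[OF assms(2-4)] prob_compl[OF Z_exceeds_sets[of r]]
    by (simp add: r_def)
qed

end

section \<open>The high-probability bound, including vanishing noise\<close>

theorem theorem3:
  fixes M :: "'a measure"
    and F :: "nat \<Rightarrow> 'a measure"
    and X :: "nat \<Rightarrow> 'a \<Rightarrow> 'h::{real_inner, complete_space, second_countable_topology}"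
    and \<epsilon> \<sigma> :: "nat \<Rightarrow> 'a \<Rightarrow> real"
    and n :: nat and B \<rho> C \<delta> :: real
  assumes "prob_space M"
    and "\<And>t. subalgebra M (F t)"
    and "\<And>s t. s \<le> t \<Longrightarrow> sets (F s) \<subseteq> sets (F t)"
    and "n > 0"
    and "\<And>t. t \<in> {1..n} \<Longrightarrow> X t \<in> borel_measurable (F (t - 1))"
    and "\<And>t. t \<in> {1..n} \<Longrightarrow> \<epsilon> t \<in> borel_measurable (F t)"
    and "\<And>t. t \<in> {1..n} \<Longrightarrow> AE w in M. real_cond_exp M (F (t - 1)) (\<epsilon> t) w = 0"
    and "\<And>i. i \<in> {1..n} \<Longrightarrow> AE w in M. \<bar>\<epsilon> i w\<bar> \<le> B"
    and "\<And>i. i \<in> {1..n} \<Longrightarrow> \<sigma> i \<in> borel_measurable (F (i - 1))"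
    and "\<And>i. i \<in> {1..n} \<Longrightarrow> AE w in M.
           real_cond_exp M (F (i - 1))
             (\<lambda>v. (\<epsilon> i v - real_cond_exp M (F (i - 1)) (\<epsilon> i) v)\<^sup>2) w \<le> (\<sigma> i w)\<^sup>2"
    and "\<rho> > 0"
    and "C \<ge> 0"
    and "AE w in M. (\<Sum>i\<in>{1..n}. (\<sigma> i w)\<^sup>2 *
           (norm (inv_sqrt_op (regop \<rho> X i w) (X i w)))\<^sup>2) \<le> C\<^sup>2"
    and "0 < \<delta>" and "\<delta> < 1"
  shows "measure M {w \<in> space M.
           Max ((\<lambda>t. norm (inv_sqrt_op (regop \<rho> X t w) (Msum X \<epsilon> t w))) ` {1..n})
             \<le> C\<^sup>2 / B * hfun_inv (B\<^sup>2 / C\<^sup>2 * ln (2 / \<delta>))} \<ge> 1 - \<delta>"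
proof (cases "0 < B")
  case True
  interpret prob_space M by fact
  interpret self_normalized_martingale M F X \<epsilon> \<sigma> n B \<rho> C
    by unfold_locales (fact assms True)+
  show ?thesis by (rule concentration) fact+
next
  case False
  interpret prob_space M by fact
  have ball: "AE w in M. \<forall>i\<in>{1..n}. \<bar>\<epsilon> i w\<bar> \<le> B"
    by (rule AE_finite_allI) (auto intro: assms(8))
  \<comment> \<open>Index 1 lies in \<open>{1..n}\<close>, so \<open>B\<close> bounds an absolute
    value; a constant statement that holds almost surely in a probability space is true.\<close>
  then have "AE w in M. 0 \<le> B"
    by eventually_elim (use \<open>n > 0\<close> in fastforce)
  then have B: "B = 0" using False by simp
  txt \<open>For \<open>B = 0\<close> the right-hand side is \<open>0\<close> because \<open>x / 0 = 0\<close>, and the noise vanishes.\<close>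
  let ?E = "{w \<in> space M. Max ((\<lambda>t. norm (inv_sqrt_op (regop \<rho> X t w) (Msum X \<epsilon> t w))) ` {1..n}) \<le> 0}"
  have X_M: "X i \<in> borel_measurable M" "\<epsilon> i \<in> borel_measurable M" if "i \<in> {1..n}" for i
    using measurable_from_subalg[OF assms(2) assms(5)[OF that]]
      measurable_from_subalg[OF assms(2) assms(6)[OF that]] by auto
  have meas: "(\<lambda>w. norm (inv_sqrt_op (regop \<rho> X t w) (Msum X \<epsilon> t w))) \<in> borel_measurable M"
    if "t \<in> {1..n}" for t
    unfolding Msum_def using that X_M
    by (intro borel_measurable_norm_inv_sqrt_regop assms borel_measurable_sum borel_measurable_scaleR) auto
  \<comment> \<open>Measurability of \<open>?E\<close>, needed to pass from an almost sure statement
    to probability 1.\<close>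
  have "(\<Inter>t\<in>{1..n}. {w \<in> space M. norm (inv_sqrt_op (regop \<rho> X t w) (Msum X \<epsilon> t w)) \<le> 0}) \<in> sets M"
    using \<open>n > 0\<close> meas by (intro sets.finite_INT borel_measurable_le) auto
  also have "(\<Inter>t\<in>{1..n}. {w \<in> space M. norm (inv_sqrt_op (regop \<rho> X t w) (Msum X \<epsilon> t w)) \<le> 0}) = ?E"
  proof -
    have "{1..n} \<noteq> {}" using \<open>n > 0\<close> by simp
    then show ?thesis by (subst Max_le_iff) blast+
  qed
  finally have E: "?E \<in> events" .
  have "AE w in M. w \<in> ?E"
    using ball AE_space
  proof eventually_elim
    case (elim w)
    have "inv_sqrt_op (regop \<rho> X t w) (Msum X \<epsilon> t w) = 0" if "t \<in> {1..n}" for t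
    proof -
      have "Msum X \<epsilon> t w = 0" unfolding Msum_def using elim that B by (intro sum.neutral) auto
      then show ?thesis
        using linear_0[OF bounded_linear.linear[OF
            coercive_operator.inv_sqrt_op_bounded_linear[OF coercive_regop[OF \<open>\<rho> > 0\<close>]]]]
        by simp
    qed
    then show ?case using elim \<open>n > 0\<close> by auto
  qed
  then have "prob ?E = 1" using E by (simp add: prob_eq_1)
  then show ?thesis using B \<open>0 < \<delta>\<close> by simp
qed

end
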